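(* Let $n\in\mathbb{N}$, $n\ge 1$, let $X$ be a Banach two-sided $\mathbb{R}_n$-module, let $m\in\mathbb{N}$ (possibly $m=0$) and let $P(\mathrm{x})=\sum_{k=0}^{m+2}\mathrm{x}^k a_k\in\mathbb{R}[\mathrm{x}]$ with $a_{m+2}\neq 0$. Let $\lambda_1,\dots,\lambda_h\in\mathbb{C}$ be the distinct complex roots of $P$, with multiplicities $m_1,\dots,m_h$, and set $r_P:=\min\{\Re(\lambda_1),\dots,\Re(\lambda_h)\}$. Let $g_P\in C^\infty([0,\infty);\mathbb{R})$ be the unique solution of $$\sum_{k=0}^{m+2}(-1)^k a_k\, g^{(k)}=0 \text{ on } [0,\infty),\qquad g(0)=g'(0)=\dots=g^{(m)}(0)=0,\qquad g^{(m+1)}(0)=(-1)^m (a_{m+2})^{-1}.$$ Let $\mathsf{T}:[0,\infty)\to\mathscr{L}^r(X)$ be a strongly continuous right linear semigroup, let $\mathsf{A}:D(\mathsf{A})\to X$ be its generator, and let $\omega\in\mathbb{R}$ be such that $M:=\sup_{t\in[0,\infty)}\|\mathsf{T}(t)\|e^{-\omega t}<\infty$. If $r_P>\omega$, then the operator $P(\mathsf{A}):D(\mathsf{A}^{m+2})\to X$ is bijective, $P(\mathsf{A})^{-1}\in\mathscr{L}^r(X)$, and $$P(\mathsf{A})^{-1}x=\int_0^\infty \mathsf{T}(t)g_P(t)x\,dt\qquad\forall x\in X,$$ $$\|P(\mathsf{A})^{-1}\|\le M\sum_{j=1}^h\sum_{k=1}^{m_j}\frac{|c_{-k}^{(j)}|}{(r_P-\omega)^k},$$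 where $c_{-k}^{(j)}$ is the residue at $\lambda_j$ of the meromorphic function $z\mapsto a_{m+2}(z-\lambda_j)^{k-1}/P(-z)$. Furthermore, for every $(p_0,p_1,\dots,p_{m+1})\in(\mathbb{R}_n)^{m+2}$, $$\sum_{j=0}^{m+1}\mathsf{A}^jP(\mathsf{A})^{-1}p_jx=\int_0^\infty\mathsf{T}(t)\left(\sum_{j=0}^{m+1}g_P^{(j)}(t)(-1)^jp_jx\right)dt\qquad\forall x\in X.$$
   Context: $\mathbb{R}_n$ is the Clifford algebra $C\ell(0,n)$: the associative unital real algebra of dimension $2^n$ with basis $\{e_K\}_{K\subseteq\{1,\dots,n\}}$, $e_\varnothing=1$, $e_k:=e_{\{k\}}$ with $e_k^2=-1$, $e_ke_l=-e_le_k$ for $k\ne l$, and $e_K=e_{k_1}\cdots e_{k_s}$ if $K=\{k_1<\dots<k_s\}$. It is equipped with the Clifford conjugation $\overline{q}=\sum_K(-1)^{|K|(|K|+1)/2}a_Ke_K$ for $q=\sum_K a_Ke_K$ ($a_K\in\mathbb{R}$) and with the Clifford operator norm $|q|:=\sup\{|qa|_{2^n}: |a|_{2^n}=1\}$, where $|\cdot|_{2^n}$ is the Euclidean norm of $\mathbb{R}^{2^n}$. $\mathbb{R}$ is identified with $\mathbb{R}1\subset\mathbb{R}_n$. Let $\mathbb{A}=\mathbb{R}_n$. A two-sided $\mathbb{A}$-module $X$ is a commutative group $(X,+)$ with left and right scalar multiplications by $\mathbb{A}$, each distributive in both arguments, with $1x=x=x1$, $p(qx)=(pq)x$, $(xp)q=x(pq)$,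 $p(xq)=(px)q$ for $p,q\in\mathbb{A}$, and $rx=xr$ for $r\in\mathbb{R}$. It is a Banach two-sided $\mathbb{A}$-module if it has a function $\|\cdot\|:X\to[0,\infty)$ with $\|x\|=0\iff x=0$, $\|x+y\|\le\|x\|+\|y\|$, $\|qx\|\le|q|\|x\|$, $\|xq\|\le|q|\|x\|$, and the metric $\|x-y\|$ is complete. In particular $X$ is a real Banach space, and $X$-valued integrals are Lebesgue (Bochner) integrals in it. A right linear operator is an additive map $\mathsf{A}:D(\mathsf{A})\to X$, where $D(\mathsf{A})\subseteq X$ is a right $\mathbb{A}$-submodule (an additive subgroup closed under right multiplication by $\mathbb{A}$), with $\mathsf{A}(xq)=\mathsf{A}(x)q$. $\mathscr{L}^r(X)$ is the set of right linear $\mathsf{B}:X\to X$ with $\|\mathsf{B}\|:=\sup_{x\ne0}\|\mathsf{B}x\|/\|x\|<\infty$. Powers: $\mathsf{A}^0=\mathrm{Id}$ and $D(\mathsf{A}^k)=\{x\in D(\mathsf{A}^{k-1}):\mathsf{A}^{k-1}x\in D(\mathsf{A})\}$. For a real polynomial $P(\mathrm{x})=\sum_{k=0}^{m+2}\mathrm{x}^ka_k$, $P(\mathsf{A}):=\sum_{k=0}^{m+2}\mathsf{A}^ka_k$ with domain $D(\mathsf{A}^{m+2})$. Notation such as $\mathsf{B}px$ means $\mathsf{B}(px)$, where $px$ is left scalar multiplication. A strongly continuous right linear semigroup is a map $\mathsf{T}:[0,\infty)\to\mathscr{L}^r(X)$ such that $t\mapsto\mathsf{T}(t)x$ is continuous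 for every $x\in X$, $\mathsf{T}(t+s)=\mathsf{T}(t)\mathsf{T}(s)$ for $t,s>0$, and $\mathsf{T}(0)=\mathrm{Id}$. Its generator is $\mathsf{A}x:=\lim_{h\to0^+}\frac1h(\mathsf{T}(h)x-x)$, with $D(\mathsf{A})$ the set of $x\in X$ for which this limit exists in $X$.
   Formalization: The norm bound as printed is false; here c_{-k}^{(j)} is the residue at -λ_j of (z+λ_j)^{k-1}/P(-z), instead of the residue at λ_j of a_{m+2}(z-λ_j)^{k-1}/P(-z). *)

theory Defs
  imports "HOL-Complex_Analysis.Complex_Analysis"
begin

no_notation fps_nth (infixl \<open>$\<close> 75)

section \<open>The Clifford algebra $C\ell(0,n)$\<close>

text \<open>
  The index set $\{1,\dots,n\}$, $n \geq 1$, is modelled by a finite linearly ordered type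
  \<^typ>\<open>'n\<close> with $n$ elements. A Clifford number is the family of its $2^n$ real coordinates with
  respect to the basis $e_K$, $K \subseteq \{1,\dots,n\}$.
\<close>

typedef (overloaded) ('n::"{finite,linorder}") clifford = "UNIV :: (real ^ ('n set)) set"
  morphisms coords Clifford ..

setup_lifting type_definition_clifford

text \<open>
  $e_K e_L = \pm e_{K \triangle L}$: sorting the word $e_K e_L$ costs one sign for every pair
  $k \in K$, $l \in L$ with $k > l$ (the generators anticommute), and every common index $k = l$
  costs another one ($e_k^2 = -1$).
\<close>

definition clifford_sign :: "'n::{finite,linorder} set \<Rightarrow> 'n set \<Rightarrow> real" where
  "clifford_sign K L = (\<Prod>k\<in>K. \<Prod>l\<in>L. if l \<le> k then - 1 else 1)"

lemma prod_sym_diff: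
  fixes f :: "'a \<Rightarrow> real"
  assumes "finite K" "finite L" "\<And>k. f k * f k = 1"
  shows "prod f (sym_diff K L) = prod f K * prod f L"
proof -
  have K: "prod f K = prod f (K - L) * prod f (K \<inter> L)"
    using assms(1) by (metis prod.Int_Diff mult.commute)
  have L: "prod f L = prod f (L - K) * prod f (K \<inter> L)"
    using assms(2) by (metis prod.Int_Diff mult.commute Int_commute)
  have "prod f (K \<inter> L) * prod f (K \<inter> L) = 1"
    by (simp add: prod.distrib [symmetric] assms(3))
  moreover have "prod f (sym_diff K L) = prod f (K - L) * prod f (L - K)"
    using assms by (intro prod.union_disjoint) auto
  ultimately show ?thesis
    unfolding K L by (simp add: mult.assoc mult.left_commute)
qed

lemma clifford_sign_left: "clifford_sign (sym_diff J K) L = clifford_sign J L * clifford_sign K L"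
  unfolding clifford_sign_def
  by (rule prod_sym_diff) (auto simp: prod.distrib [symmetric] intro!: prod.neutral)

lemma clifford_sign_right: "clifford_sign J (sym_diff K L) = clifford_sign J K * clifford_sign J L"
  unfolding clifford_sign_def prod.distrib [symmetric]
  by (intro prod.cong refl prod_sym_diff) (auto split: if_splits)

lemma clifford_sign_empty [simp]: "clifford_sign {} L = 1" "clifford_sign K {} = 1"
  by (simp_all add: clifford_sign_def)

instantiation clifford :: ("{finite,linorder}") real_vector
begin

lift_definition zero_clifford :: "'a clifford" is 0 .
lift_definition plus_clifford :: "'a clifford \<Rightarrow> 'a clifford \<Rightarrow> 'a clifford" is "(+)" .
lift_definition minus_clifford :: "'a clifford \<Rightarrow> 'a clifford \<Rightarrow> 'a clifford" is "(-)" .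
lift_definition uminus_clifford :: "'a clifford \<Rightarrow> 'a clifford" is uminus .
lift_definition scaleR_clifford :: "real \<Rightarrow> 'a clifford \<Rightarrow> 'a clifford" is scaleR .

instance
  by standard (transfer, simp add: algebra_simps)+

end

lift_definition clifford_basis :: "'n::{finite,linorder} set \<Rightarrow> 'n clifford" is "\<lambda>K. axis K 1" .

instantiation clifford :: ("{finite,linorder}") real_algebra_1
begin

definition one_clifford :: "'a clifford" where
  "one_clifford = clifford_basis {}"

definition times_clifford :: "'a clifford \<Rightarrow> 'a clifford \<Rightarrow> 'a clifford" where
  "times_clifford p q = (\<Sum>K\<in>UNIV. \<Sum>L\<in>UNIV.
     (coords p $ K * coords q $ L * clifford_sign K L) *\<^sub>R clifford_basis (sym_diff K L))"

lemma coords_simps: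
  "coords (p + q) $ S = coords p $ S + coords q $ S"
  "coords (c *\<^sub>R p) $ S = c * coords p $ S"
  "coords (clifford_basis K) $ S = (if K = S then 1 else 0)"
  "coords 0 $ S = 0"
  for p q :: "'a clifford"
  by (transfer, simp add: axis_def)+

lemma coords_sum: "coords (\<Sum>i\<in>I. f i :: 'a clifford) $ S = (\<Sum>i\<in>I. coords (f i) $ S)"
  by (induction I rule: infinite_finite_induct) (auto simp: coords_simps)

lemma clifford_eqI: "(\<And>S. coords p $ S = coords q $ S) \<Longrightarrow> p = q" for p q :: "'a clifford"
  by transfer (simp add: vec_eq_iff)

lemma coords_times:
  "coords (p * q) $ S = (\<Sum>K\<in>UNIV. clifford_sign K (sym_diff K S) * coords p $ K * coords q $ (sym_diff K S))"
  for p q :: "'a clifford"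
proof -
  have *: "sym_diff K L = S \<longleftrightarrow> L = sym_diff K S" for K L :: "'a set"
    by blast
  have "coords (p * q) $ S = (\<Sum>K\<in>UNIV. \<Sum>L\<in>UNIV. if L = sym_diff K S
      then clifford_sign K (sym_diff K S) * coords p $ K * coords q $ (sym_diff K S) else 0)"
    unfolding times_clifford_def coords_sum coords_simps *
    by (intro sum.cong refl) (simp add: mult_ac)
  then show ?thesis
    by simp
qed

lemma coords_basis_times:
  "coords (clifford_basis K * q) $ S = clifford_sign K (sym_diff K S) * coords q $ (sym_diff K S)"
  for q :: "'a clifford"
proof -
  have "coords (clifford_basis K * q) $ S = (\<Sum>J\<in>UNIV. if J = K
      then clifford_sign K (sym_diff K S) * coords q $ (sym_diff K S) else 0)"
    unfolding coords_times coords_simps by (intro sum.cong refl) simp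
  then show ?thesis
    by simp
qed

lemma coords_times_basis:
  "coords (p * clifford_basis L) $ S = clifford_sign (sym_diff L S) L * coords p $ (sym_diff L S)"
  for p :: "'a clifford"
proof -
  have *: "L = sym_diff J S \<longleftrightarrow> J = sym_diff L S" for J :: "'a set"
    by blast
  have "sym_diff (sym_diff L S) S = L"
    by blast
  then have "coords (p * clifford_basis L) $ S = (\<Sum>J\<in>UNIV. if J = sym_diff L S
      then clifford_sign (sym_diff L S) L * coords p $ (sym_diff L S) else 0)"
    unfolding coords_times coords_simps * by (intro sum.cong refl) simp
  then show ?thesis
    by simp
qed

instance
proof
  fix a b c :: "'a clifford"
  show "a * b * c = a * (b * c)"
  proof (rule clifford_eqI)
    fix S
    let ?s = "clifford_sign :: 'a set \<Rightarrow> _"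
    have bij: "bij (sym_diff J)" for J :: "'a set"
      by (rule bij_betw_byWitness [where f' = "sym_diff J"]) auto
    have [simp]: "sym_diff J (sym_diff J K) = K" for J K :: "'a set"
      by blast
    have "coords (a * b * c) $ S = (\<Sum>K\<in>UNIV. \<Sum>J\<in>UNIV. ?s K (sym_diff K S) *
        (?s J (sym_diff J K) * coords a $ J * coords b $ (sym_diff J K)) * coords c $ (sym_diff K S))"
      by (simp add: coords_times sum_distrib_left sum_distrib_right)
    also have "\<dots> = (\<Sum>J\<in>UNIV. \<Sum>K\<in>UNIV. ?s K (sym_diff K S) *
        (?s J (sym_diff J K) * coords a $ J * coords b $ (sym_diff J K)) * coords c $ (sym_diff K S))"
      by (rule sum.swap)
    also have "\<dots> = (\<Sum>J\<in>UNIV. \<Sum>L\<in>UNIV. ?s (sym_diff J L) (sym_diff (sym_diff J L) S) *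
        (?s J L * coords a $ J * coords b $ L) * coords c $ (sym_diff (sym_diff J L) S))"
    proof (rule sum.cong [OF refl])
      fix J :: "'a set"
      show "(\<Sum>K\<in>UNIV. ?s K (sym_diff K S) *
          (?s J (sym_diff J K) * coords a $ J * coords b $ (sym_diff J K)) * coords c $ (sym_diff K S))
        = (\<Sum>L\<in>UNIV. ?s (sym_diff J L) (sym_diff (sym_diff J L) S) *
          (?s J L * coords a $ J * coords b $ L) * coords c $ (sym_diff (sym_diff J L) S))"
        by (subst sum.reindex_bij_betw [OF bij [of J], symmetric]) simp
    qed
    also have "\<dots> = (\<Sum>J\<in>UNIV. \<Sum>L\<in>UNIV. ?s J (sym_diff J S) * coords a $ J *
        (?s L (sym_diff L (sym_diff J S)) * coords b $ L * coords c $ (sym_diff L (sym_diff J S))))"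
    proof (intro sum.cong refl)
      fix J L :: "'a set"
      define M where "M = sym_diff L (sym_diff J S)"
      have 1: "sym_diff (sym_diff J L) S = M" and 2: "sym_diff J S = sym_diff L M"
        unfolding M_def by blast+
      show "?s (sym_diff J L) (sym_diff (sym_diff J L) S) *
          (?s J L * coords a $ J * coords b $ L) * coords c $ (sym_diff (sym_diff J L) S)
        = ?s J (sym_diff J S) * coords a $ J *
          (?s L (sym_diff L (sym_diff J S)) * coords b $ L * coords c $ (sym_diff L (sym_diff J S)))"
        unfolding 1 M_def [symmetric] unfolding 2 clifford_sign_left clifford_sign_right
        by (simp add: mult_ac)
    qed
    also have "\<dots> = coords (a * (b * c)) $ S"
      by (simp add: coords_times sum_distrib_left)
    finally show "coords (a * b * c) $ S = coords (a * (b * c)) $ S" .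
  qed
  show "1 * a = a" "a * 1 = a"
    by (rule clifford_eqI, simp add: coords_basis_times coords_times_basis one_clifford_def)+
  show "(a + b) * c = a * c + b * c" "a * (b + c) = a * b + a * c"
    by (rule clifford_eqI, simp add: coords_times coords_simps algebra_simps sum.distrib)+
  show "x *\<^sub>R a * b = x *\<^sub>R (a * b)" "a * x *\<^sub>R b = x *\<^sub>R (a * b)" for x
    by (rule clifford_eqI, simp add: coords_times coords_simps sum_distrib_left mult_ac)+
  show "(0::'a clifford) \<noteq> 1"
    by (metis coords_simps(3,4) one_clifford_def zero_neq_one)
qed

end

lemma clifford_basis_times:
  "clifford_basis K * clifford_basis L = clifford_sign K L *\<^sub>R clifford_basis (sym_diff K L)"
proof (rule clifford_eqI)
  fix S
  have "L = sym_diff K S \<longleftrightarrow> sym_diff K L = S"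
    by blast
  then show "coords (clifford_basis K * clifford_basis L) $ S =
      coords (clifford_sign K L *\<^sub>R clifford_basis (sym_diff K L)) $ S"
    unfolding coords_basis_times coords_simps by auto
qed

text \<open>The defining relations of $C\ell(0,n)$, with \<^term>\<open>clifford_basis {k}\<close> in the role of $e_k$.\<close>

lemma clifford_basis_empty: "clifford_basis {} = 1"
  by (simp add: one_clifford_def)

lemma clifford_generator_square: "clifford_basis {k} * clifford_basis {k} = - 1"
  by (simp add: clifford_basis_times clifford_sign_def one_clifford_def)

lemma clifford_generator_anticommute:
  assumes "k \<noteq> l"
  shows "clifford_basis {k} * clifford_basis {l} = - (clifford_basis {l} * clifford_basis {k})"
  using assms by (auto simp: clifford_basis_times clifford_sign_def Un_commute insert_Diff_if)

lemma clifford_basis_eq_prod: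
  "clifford_basis K = (\<Prod>k\<leftarrow>sorted_list_of_set K. clifford_basis {k})"
  for K :: "'n::{finite,linorder} set"
proof (induction K rule: finite_linorder_max_induct [OF finite])
  case 1
  then show ?case by (simp add: one_clifford_def)
next
  case (2 b A)
  then have b: "b \<notin> A" by blast
  have "sorted_list_of_set (insert b A) = sorted_list_of_set A @ [b]"
    using sorted_list_of_set_sort_remdups [of "sorted_list_of_set A @ [b]"] b 2
    by (simp add: sorted_append less_imp_le sorted_sort_id del: sorted_list_of_set_insert)
  moreover have "clifford_basis A * clifford_basis {b} = clifford_basis (insert b A)"
  proof -
    have "clifford_sign A {b} = 1"
      unfolding clifford_sign_def using 2 by (intro prod.neutral) (auto simp: not_le)
    moreover have "sym_diff A {b} = insert b A"
      using b by blast
    ultimately show ?thesis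
      by (simp add: clifford_basis_times)
  qed
  ultimately show ?case
    using 2 by simp
qed

definition clifford_norm :: "'n::{finite,linorder} clifford \<Rightarrow> real" where
  "clifford_norm q = (SUP a\<in>{a. norm (coords a) = 1}. norm (coords (q * a)))"


section \<open>Banach two-sided modules and right linear operators\<close>

text \<open>
  \<open>lm q x\<close> and \<open>rm x q\<close> are the left and the right scalar multiplication. The vector space
  structure of \<^typ>\<open>'x\<close> is the one induced by $\mathbb{R} = \mathbb{R}1 \subset \mathbb{R}_n$. The norm
  axioms below make the norm homogeneous over the reals, so that assuming
  the class \<^class>\<open>banach\<close> adds nothing to the axioms of a Banach two-sided module.
\<close>

locale banach_two_sided_module =
  fixes lm :: "'n::{finite,linorder} clifford \<Rightarrow> 'x::banach \<Rightarrow> 'x"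
    and rm :: "'x \<Rightarrow> 'n clifford \<Rightarrow> 'x"
  assumes lm_add_right: "lm q (x + y) = lm q x + lm q y"
    and lm_add_left: "lm (p + q) x = lm p x + lm q x"
    and rm_add_left: "rm (x + y) q = rm x q + rm y q"
    and rm_add_right: "rm x (p + q) = rm x p + rm x q"
    and lm_one: "lm 1 x = x"
    and rm_one: "rm x 1 = x"
    and lm_assoc: "lm p (lm q x) = lm (p * q) x"
    and rm_assoc: "rm (rm x p) q = rm x (p * q)"
    and lm_rm: "lm p (rm x q) = rm (lm p x) q"
    and lm_of_real: "lm (of_real r) x = r *\<^sub>R x"
    and rm_of_real: "rm x (of_real r) = r *\<^sub>R x"
    and norm_lm: "norm (lm q x) \<le> clifford_norm q * norm x"
    and norm_rm: "norm (rm x q) \<le> clifford_norm q * norm x"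

definition right_submodule :: "('x::banach \<Rightarrow> 'n::{finite,linorder} clifford \<Rightarrow> 'x) \<Rightarrow> 'x set \<Rightarrow> bool" where
  "right_submodule rm D \<longleftrightarrow> 0 \<in> D \<and> (\<forall>x\<in>D. \<forall>y\<in>D. x + y \<in> D) \<and> (\<forall>x\<in>D. - x \<in> D) \<and>
     (\<forall>x\<in>D. \<forall>q. rm x q \<in> D)"

definition right_linear_on ::
    "('x::banach \<Rightarrow> 'n::{finite,linorder} clifford \<Rightarrow> 'x) \<Rightarrow> 'x set \<Rightarrow> ('x \<Rightarrow> 'x) \<Rightarrow> bool" where
  "right_linear_on rm D A \<longleftrightarrow> right_submodule rm D \<and>
     (\<forall>x\<in>D. \<forall>y\<in>D. A (x + y) = A x + A y) \<and> (\<forall>x\<in>D. \<forall>q. A (rm x q) = rm (A x) q)"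

text \<open>
  The elements of $\mathscr{L}^r(X)$. The norm of such an operator is \<^const>\<open>onorm\<close>; the supremum
  defining it also ranges over \<open>x = 0\<close>, which contributes the value \<open>0 / 0 = 0\<close> and only
  matters for the zero module.
\<close>

definition bounded_right_linear ::
    "('x::banach \<Rightarrow> 'n::{finite,linorder} clifford \<Rightarrow> 'x) \<Rightarrow> ('x \<Rightarrow> 'x) \<Rightarrow> bool" where
  "bounded_right_linear rm B \<longleftrightarrow> right_linear_on rm UNIV B \<and>
     bdd_above ((\<lambda>x. norm (B x) / norm x) ` (UNIV - {0}))"

text \<open>
  An operator \<open>A : D \<rightarrow> X\<close> is a total function together with its domain; \<open>A\<^sup>k\<close> is \<open>A ^^ k\<close>, which
  is meaningful on \<open>power_domain D A k\<close>.
\<close>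

primrec power_domain :: "'x set \<Rightarrow> ('x \<Rightarrow> 'x) \<Rightarrow> nat \<Rightarrow> 'x set" where
  "power_domain D A 0 = UNIV"
| "power_domain D A (Suc k) = {x \<in> power_domain D A k. (A ^^ k) x \<in> D}"

definition poly_operator :: "real poly \<Rightarrow> ('x::real_vector \<Rightarrow> 'x) \<Rightarrow> 'x \<Rightarrow> 'x" where
  "poly_operator P A x = (\<Sum>k\<le>degree P. (A ^^ k) (coeff P k *\<^sub>R x))"


section \<open>Semigroups and generators\<close>

definition right_linear_semigroup ::
    "('x::banach \<Rightarrow> 'n::{finite,linorder} clifford \<Rightarrow> 'x) \<Rightarrow> (real \<Rightarrow> 'x \<Rightarrow> 'x) \<Rightarrow> bool" where
  "right_linear_semigroup rm T \<longleftrightarrow>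
     (\<forall>t\<ge>0. bounded_right_linear rm (T t)) \<and>
     (\<forall>x. continuous_on {0..} (\<lambda>t. T t x)) \<and>
     (\<forall>t>0. \<forall>s>0. T (t + s) = T t \<circ> T s) \<and>
     T 0 = id"

definition generator_domain :: "(real \<Rightarrow> 'x::banach \<Rightarrow> 'x) \<Rightarrow> 'x set" where
  "generator_domain T = {x. \<exists>y. ((\<lambda>h. (1 / h) *\<^sub>R (T h x - x)) \<longlongrightarrow> y) (at_right 0)}"

definition generator :: "(real \<Rightarrow> 'x::banach \<Rightarrow> 'x) \<Rightarrow> 'x \<Rightarrow> 'x" where
  "generator T x = Lim (at_right 0) (\<lambda>h. (1 / h) *\<^sub>R (T h x - x))"


section \<open>Bochner integrals in arbitrary Banach spaces\<close>

text \<open>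
  The library's \<^const>\<open>has_bochner_integral\<close> is restricted to second countable spaces. The
  definition below is the same, except that Borel measurability is replaced by strong
  measurability, which is what is needed in a non-separable space.
\<close>

definition strongly_measurable :: "'a measure \<Rightarrow> ('a \<Rightarrow> 'x::banach) \<Rightarrow> bool" where
  "strongly_measurable M f \<longleftrightarrow>
     (\<exists>u. (\<forall>i::nat. simple_function M (u i)) \<and> (AE x in M. (\<lambda>i. u i x) \<longlonglongrightarrow> f x))"

definition has_strong_bochner_integral :: "'a measure \<Rightarrow> ('a \<Rightarrow> 'x::banach) \<Rightarrow> 'x \<Rightarrow> bool" where
  "has_strong_bochner_integral M f y \<longleftrightarrow> strongly_measurable M f \<and>
     (\<exists>s. (\<forall>i::nat. Bochner_Integration.simple_bochner_integrable M (s i)) \<and>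
       (\<lambda>i. \<integral>\<^sup>+x. norm (f x - s i x) \<partial>M) \<longlonglongrightarrow> 0 \<and>
       (\<lambda>i. Bochner_Integration.simple_bochner_integral M (s i)) \<longlonglongrightarrow> y)"

lemma borel_measurable_AE_complete:
  assumes "complete_measure M" "g \<in> borel_measurable M" "AE x in M. g x = f x"
  shows "f \<in> borel_measurable M"
proof (rule measurableI)
  interpret complete_measure M by fact
  fix B :: "'b::topological_space set" assume [measurable]: "B \<in> sets borel"
  have "g -` B \<inter> space M \<in> sets M"
    using assms(2) by measurable
  then show "f -` B \<inter> space M \<in> sets M"
    by (rule in_sets_AE [rotated]) (use assms(3) in \<open>auto\<close>)
qed simp

lemma has_strong_bochner_integral_iff:
  fixes f :: "'a \<Rightarrow> 'x::{banach, second_countable_topology}"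
  assumes "complete_measure M"
  shows "has_strong_bochner_integral M f y \<longleftrightarrow> has_bochner_integral M f y"
proof -
  have "strongly_measurable M f \<longleftrightarrow> f \<in> borel_measurable M"
  proof
    assume "strongly_measurable M f"
    then obtain u where u: "\<And>i::nat. simple_function M (u i)" "AE x in M. (\<lambda>i. u i x) \<longlonglongrightarrow> f x"
      unfolding strongly_measurable_def by blast
    define g where "g = (\<lambda>x. lim (\<lambda>i. u i x))"
    have [measurable]: "u i \<in> borel_measurable M" for i
      using u(1) by (rule borel_measurable_simple_function)
    have "g \<in> borel_measurable M"
      unfolding g_def by measurable
    moreover have ae: "AE x in M. g x = f x"
      using u(2) by eventually_elim (simp add: g_def limI)
    ultimately show "f \<in> borel_measurable M"
      using ae borel_measurable_AE_complete [OF assms] by blast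
  next
    assume "f \<in> borel_measurable M"
    from borel_measurable_implies_sequence_metric [OF this, of 0]
    show "strongly_measurable M f"
      unfolding strongly_measurable_def by (auto intro!: AE_I2)
  qed
  then show ?thesis
    unfolding has_strong_bochner_integral_def has_bochner_integral.simps by auto
qed


section \<open>The data attached to the polynomial\<close>

abbreviation complex_poly :: "real poly \<Rightarrow> complex poly" where
  "complex_poly P \<equiv> map_poly complex_of_real P"

definition roots :: "real poly \<Rightarrow> complex set" where
  "roots P = {z. poly (complex_poly P) z = 0}"

definition min_re_root :: "real poly \<Rightarrow> real" where
  "min_re_root P = Min (Re ` roots P)"

text \<open>The derivative of a function on $[0,\infty)$, one-sided at $0$.\<close>

definition half_line_deriv :: "(real \<Rightarrow> real) \<Rightarrow> real \<Rightarrow> real" where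
  "half_line_deriv g t = vector_derivative g (at t within {0..})"

definition solves_ivp :: "nat \<Rightarrow> real poly \<Rightarrow> (real \<Rightarrow> real) \<Rightarrow> bool" where
  "solves_ivp m P g \<longleftrightarrow>
     (\<forall>k. (half_line_deriv ^^ k) g differentiable_on {0..}) \<and>
     (\<forall>t\<ge>0. (\<Sum>k=0..m+2. (- 1) ^ k * coeff P k * (half_line_deriv ^^ k) g t) = 0) \<and>
     (\<forall>k\<le>m. (half_line_deriv ^^ k) g 0 = 0) \<and>
     (half_line_deriv ^^ (m + 1)) g 0 = (- 1) ^ m * inverse (coeff P (m + 2))"

text \<open>The values on $(-\infty,0)$ are immaterial; they are put to \<open>0\<close> to make the solution unique.\<close>

definition ivp_solution :: "nat \<Rightarrow> real poly \<Rightarrow> real \<Rightarrow> real" where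
  "ivp_solution m P = (THE g. solves_ivp m P g \<and> (\<forall>t<0. g t = 0))"

text \<open>
  The function $z \mapsto 1/P(-z)$ is the Laplace transform of \<^term>\<open>ivp_solution m P\<close>; its poles
  are the points $-\mu$ with $P(\mu) = 0$. \<open>laurent_coeff P \<mu> k\<close> is the coefficient of
  $(z + \mu)^{-k}$ in its Laurent expansion at $-\mu$, written as a residue.
\<close>

definition laurent_coeff :: "real poly \<Rightarrow> complex \<Rightarrow> nat \<Rightarrow> complex" where
  "laurent_coeff P \<mu> k = residue (\<lambda>z. (z + \<mu>) ^ (k - 1) / poly (complex_poly P) (- z)) (- \<mu>)"

end

theory Submission
  imports Defs
begin

text \<open>
  Let \<open>\<phi>\<close> be a smooth weight that decays faster than the semigroup can grow, and let
  \<open>I \<phi> x\<close> be the integral of \<open>\<phi> t *\<^sub>R T t x\<close> over the half-line. Formally \<open>A T t = (T t)'\<close>,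
  so an integration by parts gives \<open>A (I \<phi> x) = - \<phi> 0 *\<^sub>R x - I \<phi>' x\<close>
  (\<open>generator_weighted_mean\<close>): the generator turns into differentiation of the weight, up to a
  boundary term. Take for \<open>\<phi>\<close> the solution \<open>g\<close> of the initial value problem, whose Laplace
  transform is \<open>1 / P (- z)\<close>. The vanishing initial values kill all boundary terms up to the
  power \<open>m + 1\<close> of the generator, so \<open>A ^^ j\<close> sends \<open>I g x\<close> to \<open>(- 1) ^ j\<close> times the mean with weight the
  \<open>j\<close>-th derivative of \<open>g\<close>. The last initial value is chosen so that the boundary term in the
  power \<open>m + 2\<close> contributes exactly \<open>x\<close> to \<open>P(A) (I g x)\<close>, and the differential equation makes the remaining
  integral vanish. Hence \<open>I g\<close> is a right inverse of \<open>P(A)\<close>. Since \<open>I g\<close> commutes with the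
  semigroup, it commutes with \<open>A\<close>, and it is a left inverse too
  (\<open>poly_operator_kernel_mean\<close>, \<open>kernel_mean_poly_operator\<close>). The formulas for \<open>A ^^ j\<close> obtained on the
  way, applied to \<open>lm (p j) x\<close> in place of \<open>x\<close>, are the last assertion.

  The norm estimate needs \<open>g\<close> explicitly. It is the sum of the residues of
  \<open>exp (t z) / P (- z)\<close>, a combination of the functions \<open>t ^ k / fact k * exp (- \<mu> * t)\<close>
  with \<open>\<mu>\<close> a root of \<open>P\<close> and \<open>k\<close> below its order; the coefficients are the Laurent coefficients at \<open>- \<mu>\<close>.
  More generally \<open>inverse_laplace p N\<close> is the sum of the residues of \<open>exp (t z) N(z) / p(- z)\<close>.
  Differentiation in \<open>t\<close> multiplies \<open>N\<close> by \<open>z\<close>. Therefore the differential operator of the problem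
  replaces \<open>N\<close> by a multiple of \<open>p(- z)\<close>, which cancels all poles, and the
  initial values are sums of residues of rational functions, which the behaviour at infinity determines
  (\<open>sum_residues_eq_limit_at_infinity\<close>). An energy estimate shows that the problem has no
  other solution, so \<open>g\<close> is this function. Finally the integral of
  \<open>t ^ k / fact k * exp (- (r - \<omega>) * t)\<close> is at most \<open>1 / (r - \<omega>) ^ (k + 1)\<close>.

  All integrands are continuous and decay exponentially in norm. For such functions the gauge integral over
  the half-line exists in every Banach space and obeys the usual rules, so the calculations are
  made with it; \<open>exp_decaying_has_strong_bochner_integral\<close> shows that it is also the
  Bochner integral.
\<close>

section \<open>Exponentially decaying functions on the half-line\<close>

definition exp_decaying :: "(real \<Rightarrow> 'a::real_normed_vector) \<Rightarrow> bool" where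
  "exp_decaying f \<longleftrightarrow> continuous_on {0..} f \<and>
     (\<exists>K b. 0 < b \<and> (\<forall>t\<ge>0. norm (f t) \<le> K * exp (- b * t)))"

lemma exp_decayingI:
  assumes "continuous_on {0..} f" "0 < b" "\<And>t. 0 \<le> t \<Longrightarrow> norm (f t) \<le> K * exp (- b * t)"
  shows "exp_decaying f"
  using assms unfolding exp_decaying_def by blast

lemma exp_decayingE:
  assumes "exp_decaying f"
  obtains K b where "0 < b" "0 < K" "\<And>t. 0 \<le> t \<Longrightarrow> norm (f t) \<le> K * exp (- b * t)"
proof -
  from assms obtain K b where b: "0 < b" and f: "\<And>t. 0 \<le> t \<Longrightarrow> norm (f t) \<le> K * exp (- b * t)"
    unfolding exp_decaying_def by blast
  have "norm (f t) \<le> (\<bar>K\<bar> + 1) * exp (- b * t)" if "0 \<le> t" for t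
    by (rule order_trans [OF f [OF that]]) (intro mult_right_mono, auto)
  with b show ?thesis
    by (intro that [of b "\<bar>K\<bar> + 1"]) auto
qed

lemma integral_le_exp_tail:
  fixes f :: "real \<Rightarrow> 'a::banach"
  assumes "continuous_on {0..} f" "0 < b" "0 < K"
    and f: "\<And>t. 0 \<le> t \<Longrightarrow> norm (f t) \<le> K * exp (- b * t)"
    and "0 \<le> c" "c \<le> d"
  shows "norm (integral {c..d} f) \<le> K * exp (- b * c) / b"
proof -
  have "((\<lambda>t. K * exp (- b * t)) has_integral
      (- K * exp (- b * d) / b) - (- K * exp (- b * c) / b)) {c..d}"
    using assms by (intro fundamental_theorem_of_calculus)
      (auto intro!: derivative_eq_intros simp flip: has_real_derivative_iff_has_vector_derivative)
  then have "norm (integral {c..d} f) \<le> (- K * exp (- b * d) / b) - (- K * exp (- b * c) / b)"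
    using assms by (intro integral_norm_bound_integral [THEN order_trans, OF _ _ _ eq_refl [OF integral_unique]])
      (auto intro!: integrable_continuous_interval continuous_intros intro: continuous_on_subset)
  also have "\<dots> \<le> K * exp (- b * c) / b"
    using assms by simp
  finally show ?thesis .
qed

text \<open>
  By \<open>integral_le_exp_tail\<close> the integrals over bounded intervals form a Cauchy net, so completeness of the
  space provides the limit.
\<close>

lemma exp_decaying_integrable:
  fixes f :: "real \<Rightarrow> 'a::banach"
  assumes "exp_decaying f"
  shows "f integrable_on {0..}"
proof -
  from assms have cont: "continuous_on {0..} f"
    by (simp add: exp_decaying_def)
  from assms obtain K b where b: "0 < b" and K: "0 < K"
    and f: "\<And>t. 0 \<le> t \<Longrightarrow> norm (f t) \<le> K * exp (- b * t)"
    by (rule exp_decayingE) blast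
  have int: "f integrable_on {c..d}" if "0 \<le> c" for c d
    using that by (intro integrable_continuous_interval continuous_on_subset [OF cont]) auto
  let ?F = "\<lambda>t. if t \<in> {0..} then f t else 0"
  have restr: "(?F has_integral integral {max 0 c..d} f) {c..d}" for c d
  proof -
    have "((\<lambda>t. if t \<in> {max 0 c..d} then f t else 0) has_integral integral {max 0 c..d} f) {c..d}"
      by (subst has_integral_restrict) (auto intro!: integrable_integral int)
    then show ?thesis
      by (rule has_integral_eq [rotated]) auto
  qed
  have tail: "norm (integral {0..c} f - integral {0..d} f) \<le> K * exp (- b * B) / b"
    if "0 \<le> B" "B \<le> c" "B \<le> d" for B c d
  proof -
    have le: "norm (integral {0..c} f - integral {0..d} f) \<le> K * exp (- b * B) / b"
      if "0 \<le> B" "B \<le> c" "c \<le> d" for c d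
    proof -
      have "integral {0..c} f + integral {c..d} f = integral {0..d} f"
        using that int by (intro Henstock_Kurzweil_Integration.integral_combine) auto
      then have "norm (integral {0..c} f - integral {0..d} f) = norm (integral {c..d} f)"
        by (metis add_diff_cancel_left' norm_minus_commute)
      also have "\<dots> \<le> K * exp (- b * c) / b"
        using that by (intro integral_le_exp_tail cont b K f) auto
      also have "\<dots> \<le> K * exp (- b * B) / b"
        using that b K by (simp add: divide_right_mono)
      finally show ?thesis .
    qed
    show ?thesis
      using le [of c d] le [of d c] that by (cases "c \<le> d") (auto simp: norm_minus_commute)
  qed
  have "\<exists>B>0. \<forall>c d c' d'. ball 0 B \<subseteq> cbox c d \<and> ball 0 B \<subseteq> cbox c' d' \<longrightarrow>
      norm (integral (cbox c d) ?F - integral (cbox c' d') ?F) < e" if "0 < e" for e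
  proof -
    have "((\<lambda>B. K * exp (- b * B) / b) \<longlongrightarrow> 0) at_top"
      using b by real_asymp
    then have "\<forall>\<^sub>F B in at_top. K * exp (- b * B) / b < e \<and> B > 0"
      using that by (intro eventually_conj order_tendstoD(2) eventually_gt_at_top) auto
    then obtain B where B: "K * exp (- b * B) / b < e" "0 < B"
      by (auto dest: eventually_happens)
    have end_points: "max 0 c = 0 \<and> B \<le> d" if "ball 0 B \<subseteq> cbox c d" for c d :: real
    proof -
      have "closure (ball 0 B) \<subseteq> cbox c d"
        using that by (rule closure_minimal) simp
      then have "cball 0 B \<subseteq> {c..d}"
        using B by simp
      from subsetD [OF this, of B] subsetD [OF this, of 0] have "B \<in> {c..d}" "0 \<in> {c..d}"
        using B by (auto simp del: atLeastAtMost_iff)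
      then show ?thesis
        by auto
    qed
    show ?thesis
    proof (intro exI [of _ B] conjI allI impI B(2))
      fix c d c' d' :: real
      assume "ball 0 B \<subseteq> cbox c d \<and> ball 0 B \<subseteq> cbox c' d'"
      then have "max 0 c = 0" "B \<le> d" "max 0 c' = 0" "B \<le> d'"
        using end_points by blast+
      then show "norm (integral (cbox c d) ?F - integral (cbox c' d') ?F) < e"
        using tail [of B d d'] B integral_unique [OF restr [of c d]] integral_unique [OF restr [of c' d']]
        by simp
    qed
  qed
  moreover have "?F integrable_on cbox c d" for c d
    using has_integral_integrable [OF restr [of c d]] by simp
  ultimately show ?thesis
    unfolding integrable_alt [of f] by blast
qed

text \<open>
  This function dominates the part beyond \<open>N\<close> of an exponentially decaying function; its integral over the
  whole half-line bounds every truncation error.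
\<close>

lemma has_integral_exp_tail:
  fixes b K N :: real
  assumes "0 < b" "0 \<le> N"
  shows "((\<lambda>t. if t \<in> {N..} then K * exp (- b * t) else 0) has_integral K * (exp (- b * N) / b)) {0..}"
  using assms has_integral_mult_right [OF has_integral_exp_minus_to_infinity [OF assms(1)], of K N]
  by (subst has_integral_restrict) auto

lemma exp_decaying_scaleR:
  assumes "exp_decaying f"
  shows "exp_decaying (\<lambda>t. c *\<^sub>R f t)"
proof -
  from assms obtain K b where "0 < b" "\<And>t. 0 \<le> t \<Longrightarrow> norm (f t) \<le> K * exp (- b * t)"
    by (rule exp_decayingE) blast
  then have "norm (c *\<^sub>R f t) \<le> (\<bar>c\<bar> * K) * exp (- b * t)" if "0 \<le> t" for t
    using that by (simp add: mult.assoc mult_left_mono)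
  with assms \<open>0 < b\<close> show ?thesis
    
    by (intro exp_decayingI [where K = "\<bar>c\<bar> * K"]) (auto intro!: continuous_intros simp: exp_decaying_def)
qed

lemma exp_decaying_add:
  assumes f: "exp_decaying f" and g: "exp_decaying g"
  shows "exp_decaying (\<lambda>t. f t + g t)"
proof -
  obtain K b where 1: "0 < b" "0 < K" "\<And>t. 0 \<le> t \<Longrightarrow> norm (f t) \<le> K * exp (- b * t)"
    using f by (rule exp_decayingE) blast
  obtain L c where 2: "0 < c" "0 < L" "\<And>t. 0 \<le> t \<Longrightarrow> norm (g t) \<le> L * exp (- c * t)"
    using g by (rule exp_decayingE) blast
  have "norm (f t + g t) \<le> (K + L) * exp (- (min b c) * t)" if "0 \<le> t" for t
  proof -
    have "norm (f t + g t) \<le> K * exp (- b * t) + L * exp (- c * t)"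
      using 1(3) 2(3) that by (meson add_mono norm_triangle_ineq order_trans)
    also have "\<dots> \<le> K * exp (- (min b c) * t) + L * exp (- (min b c) * t)"
      using 1 2 that by (intro add_mono mult_left_mono) (auto intro: mult_right_mono)
    finally show ?thesis
      by (simp add: algebra_simps)
  qed
  moreover have "0 < min b c"
    using 1 2 by simp
  ultimately show ?thesis
    using f g 
    by (intro exp_decayingI [where b = "min b c"]) (auto intro!: continuous_on_add simp: exp_decaying_def)
qed

lemma exp_decaying_sum:
  assumes "\<And>i. i \<in> I \<Longrightarrow> exp_decaying (f i)"
  shows "exp_decaying (\<lambda>t. \<Sum>i\<in>I. f i t)"
proof -
  have "exp_decaying (\<lambda>t. 0)"
    unfolding exp_decaying_def by (auto intro!: exI [of _ 0] exI [of _ 1])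
  with assms show ?thesis
    by (induction I rule: infinite_finite_induct) (auto intro: exp_decaying_add)
qed

lemma exp_decaying_cong:
  assumes "\<And>t. 0 \<le> t \<Longrightarrow> f t = g t"
  shows "exp_decaying f \<longleftrightarrow> exp_decaying g"
proof -
  have "continuous_on {0..} f \<longleftrightarrow> continuous_on {0..} g"
    using assms by (intro continuous_on_cong) auto
  with assms show ?thesis
    by (simp add: exp_decaying_def)
qed

lemma integral_half_line_diff_le:
  fixes f :: "real \<Rightarrow> 'a::banach"
  assumes f: "exp_decaying f" and b: "0 < b"
    and le: "\<And>t. 0 \<le> t \<Longrightarrow> norm (f t) \<le> K * exp (- b * t)" and "0 \<le> N"
  shows "norm (integral {0..} f - integral {0..N} f) \<le> K * (exp (- b * N) / b)"
proof -
  have "f integrable_on {0..N}"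
    using f by (intro integrable_continuous_interval) (auto simp: exp_decaying_def intro: continuous_on_subset)
  then have "((\<lambda>t. if t \<in> {0..N} then f t else 0) has_integral integral {0..N} f) {0..}"
    by (subst has_integral_restrict) auto
  with integrable_integral [OF exp_decaying_integrable [OF f]]
  have "((\<lambda>t. f t - (if t \<in> {0..N} then f t else 0)) has_integral (integral {0..} f - integral {0..N} f)) {0..}"
    by (rule has_integral_diff)
  moreover have "((\<lambda>t. if t \<in> {N..} then K * exp (- b * t) else 0) has_integral K * (exp (- b * N) / b)) {0..}"
    by (rule has_integral_exp_tail [OF b \<open>0 \<le> N\<close>])
  moreover have "0 \<le> K * exp (- b * t)" if "0 \<le> t" for t
    using le [OF that] norm_ge_zero order_trans by blast
  ultimately show ?thesis
    using integral_norm_bound_integral [of "\<lambda>t. f t - (if t \<in> {0..N} then f t else 0)" "{0..}"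
        "\<lambda>t. if t \<in> {N..} then K * exp (- b * t) else 0"] le \<open>0 \<le> N\<close>
    by (auto simp: has_integral_iff)
qed

lemma integral_half_line_tendsto:
  fixes f :: "real \<Rightarrow> 'a::banach"
  assumes f: "exp_decaying f"
  shows "((\<lambda>N. integral {0..N} f) \<longlongrightarrow> integral {0..} f) at_top"
proof -
  obtain K b where b: "0 < b" and K: "0 < K" and le: "\<And>t. 0 \<le> t \<Longrightarrow> norm (f t) \<le> K * exp (- b * t)"
    using f by (rule exp_decayingE) blast
  have "((\<lambda>N. integral {0..} f - integral {0..N} f) \<longlongrightarrow> 0) at_top"
  proof (rule Lim_null_comparison)
    show "\<forall>\<^sub>F N in at_top. norm (integral {0..} f - integral {0..N} f) \<le> K * (exp (- b * N) / b)"
      using eventually_ge_at_top [of 0]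
      by eventually_elim (rule integral_half_line_diff_le [OF f b le])
    show "((\<lambda>N. K * (exp (- b * N) / b)) \<longlongrightarrow> 0) at_top"
      using b by real_asymp
  qed
  from tendsto_diff [OF tendsto_const [of "integral {0..} f"] this] show ?thesis
    by simp
qed

lemma integral_half_line_norm_le:
  fixes f :: "real \<Rightarrow> 'a::banach"
  assumes "exp_decaying f" "0 < b" "\<And>t. 0 \<le> t \<Longrightarrow> norm (f t) \<le> K * exp (- b * t)"
  shows "norm (integral {0..} f) \<le> K / b"
  using integral_half_line_diff_le [OF assms, of 0] by simp

lemma integral_half_line_shift:
  fixes f :: "real \<Rightarrow> 'a::banach"
  assumes f: "exp_decaying f" and g: "exp_decaying (\<lambda>t. f (t + h))" and "0 \<le> h"
  shows "integral {0..} f = integral {0..h} f + integral {0..} (\<lambda>t. f (t + h))"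
proof (rule tendsto_unique [OF trivial_limit_at_top_linorder])
  have int: "f integrable_on {0..c}" for c
    using f by (intro integrable_continuous_interval) (auto simp: exp_decaying_def intro: continuous_on_subset)
  show "((\<lambda>N. integral {0..N + h} f) \<longlongrightarrow> integral {0..} f) at_top"
    by (rule filterlim_compose [OF integral_half_line_tendsto [OF f]]) real_asymp
  have "integral {0..N + h} f = integral {0..h} f + integral {0..N} (\<lambda>t. f (t + h))" if "0 \<le> N" for N
  proof -
    have "integral {0..h} f + integral {h..N + h} f = integral {0..N + h} f"
      using that \<open>0 \<le> h\<close> int by (intro Henstock_Kurzweil_Integration.integral_combine) auto
    moreover have "integral {0..N} (\<lambda>t. f (t + h)) = integral {h..N + h} f"
      using integral_shift_Icc_real [of 0 N f h] by (simp add: o_def add.commute)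
    ultimately show ?thesis
      by simp
  qed
  then have "\<forall>\<^sub>F N in at_top. integral {0..h} f + integral {0..N} (\<lambda>t. f (t + h)) = integral {0..N + h} f"
    by (intro eventually_mono [OF eventually_ge_at_top [of 0]]) simp
  moreover have "((\<lambda>N. integral {0..h} f + integral {0..N} (\<lambda>t. f (t + h))) \<longlongrightarrow>
      integral {0..h} f + integral {0..} (\<lambda>t. f (t + h))) at_top"
    by (intro tendsto_intros integral_half_line_tendsto g)
  ultimately show "((\<lambda>N. integral {0..N + h} f) \<longlongrightarrow>
      integral {0..h} f + integral {0..} (\<lambda>t. f (t + h))) at_top"
    by (rule Lim_transform_eventually [rotated])
qed

text \<open>
  A single term of the exponential series of \<open>d * s\<close>: any small exponential rate absorbs a polynomial factor.
\<close>

lemma power_over_fact_le_exp: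
  fixes d s :: real
  assumes "0 < d" "0 \<le> s"
  shows "s ^ k / fact k \<le> exp (d * s) / d ^ k"
proof -
  have "(d * s) ^ k / fact k \<le> (\<Sum>i\<le>k. (d * s) ^ i / fact i)"
    using assms by (intro member_le_sum) auto
  also have "\<dots> \<le> exp (d * s)"
    using assms summable_exp [of "d * s"]
    by (auto simp: exp_def divide_inverse mult.commute intro!: sum_le_suminf)
  finally show ?thesis
    using assms by (simp add: power_mult_distrib field_simps)
qed

text \<open>
  Integration by parts lowers \<open>k\<close> by one, gains a factor \<open>1 / a\<close>, and leaves a boundary
  term at \<open>N\<close> of the favourable sign.
\<close>

lemma integral_power_exp_le:
  fixes a N :: real
  assumes "0 < a" "0 \<le> N"
  shows "integral {0..N} (\<lambda>t. t ^ k / fact k * exp (- a * t)) \<le> 1 / a ^ Suc k"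
proof (induction k)
  case 0
  have "((\<lambda>t. exp (- a * t)) has_integral (- exp (- a * N) / a) - (- exp (- a * 0) / a)) {0..N}"
    using assms by (intro fundamental_theorem_of_calculus)
      (auto intro!: derivative_eq_intros simp flip: has_real_derivative_iff_has_vector_derivative)
  from integral_unique [OF this] show ?case
    using assms(1) by (simp add: divide_right_mono)
next
  case (Suc k)
  let ?e = "\<lambda>k t. t ^ k / fact k * exp (- a * t)"
  have fact: "((\<lambda>t. t ^ Suc k / fact (Suc k)) has_real_derivative t ^ k / fact k) (at t within S)" for t :: real and S
  proof -
    have "((\<lambda>t. t ^ Suc k / fact (Suc k)) has_real_derivative (real (Suc k) * t ^ k) / fact (Suc k)) (at t within S)"
      by (rule DERIV_cdivide) (auto intro!: derivative_eq_intros simp del: power_Suc)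
    moreover have "(real (Suc k) * t ^ k) / fact (Suc k) = t ^ k / fact k"
      by (simp del: of_nat_Suc)
    ultimately show ?thesis
      by simp
  qed
  have "((\<lambda>t. ?e (Suc k) t - ?e k t / a) has_integral (- ?e (Suc k) N / a) - (- ?e (Suc k) 0 / a)) {0..N}"
  proof (rule fundamental_theorem_of_calculus [OF assms(2)])
    fix t :: real
    have "((\<lambda>t. - ?e (Suc k) t / a) has_real_derivative
        - (t ^ Suc k / fact (Suc k) * (- a * exp (- a * t)) + t ^ k / fact k * exp (- a * t)) / a) (at t within {0..N})"
      by (intro DERIV_cdivide DERIV_minus DERIV_mult' fact) (auto intro!: derivative_eq_intros)
    also have "- (t ^ Suc k / fact (Suc k) * (- a * exp (- a * t)) + t ^ k / fact k * exp (- a * t)) / a =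
        ?e (Suc k) t - ?e k t / a"
      using assms(1) by (simp add: add_divide_distrib diff_divide_distrib del: power_Suc fact_Suc)
    finally show "((\<lambda>t. - ?e (Suc k) t / a) has_vector_derivative ?e (Suc k) t - ?e k t / a) (at t within {0..N})"
      by (simp only: has_real_derivative_iff_has_vector_derivative)
  qed
  moreover have "(?e i has_integral integral {0..N} (?e i)) {0..N}" for i
    by (intro integrable_integral integrable_continuous_interval continuous_intros) auto
  then have "((\<lambda>t. ?e (Suc k) t - ?e k t / a) has_integral integral {0..N} (?e (Suc k)) - integral {0..N} (?e k) / a) {0..N}"
    by (intro has_integral_diff has_integral_divide)
  ultimately have "integral {0..N} (?e (Suc k)) - integral {0..N} (?e k) / a = (- ?e (Suc k) N / a) - (- ?e (Suc k) 0 / a)"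
    by (rule has_integral_unique [rotated])
  moreover have "0 \<le> ?e (Suc k) N / a"
    using assms by simp
  ultimately have "integral {0..N} (?e (Suc k)) \<le> integral {0..N} (?e k) / a"
    by (simp del: power_Suc fact_Suc)
  also have "\<dots> \<le> (1 / a ^ Suc k) / a"
    using Suc.IH assms(1) by (intro divide_right_mono) auto
  finally show ?case
    by (simp add: mult.commute)
qed

lemma exp_decaying_power_exp:
  fixes a :: real
  assumes "0 < a"
  shows "exp_decaying (\<lambda>t. t ^ k / fact k * exp (- a * t))"
proof (rule exp_decayingI)
  show "0 < a / 2"
    using assms by simp
  show "norm (t ^ k / fact k * exp (- a * t)) \<le> 1 / (a / 2) ^ k * exp (- (a / 2) * t)" if "0 \<le> t" for t
  proof -
    have "t ^ k / fact k * exp (- a * t) \<le> exp (a / 2 * t) / (a / 2) ^ k * exp (- a * t)"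
      using assms that by (intro mult_right_mono power_over_fact_le_exp) auto
    also have "\<dots> = 1 / (a / 2) ^ k * (exp (a / 2 * t) * exp (- a * t))"
      by simp
    also have "exp (a / 2 * t) * exp (- a * t) = exp (- (a / 2) * t)"
      by (simp add: exp_add [symmetric])
    finally show ?thesis
      using that by simp
  qed
qed (intro continuous_intros, auto)

section \<open>Bochner integrals of exponentially decaying functions\<close>

text \<open>
  A simple function is a finite combination of indicator functions of measurable sets of finite measure, and
  for those both integrals are the measure.
\<close>

lemma simple_bochner_integral_has_integral:
  fixes s :: "real \<Rightarrow> 'a::banach"
  assumes "S \<in> sets lebesgue" "Bochner_Integration.simple_bochner_integrable (lebesgue_on S) s"
  shows "(s has_integral Bochner_Integration.simple_bochner_integral (lebesgue_on S) s) S"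
proof -
  let ?L = "lebesgue_on S"
  from assms(2) have s: "simple_function ?L s" and fin: "emeasure ?L {x\<in>space ?L. s x \<noteq> 0} \<noteq> \<infinity>"
    by (auto elim: Bochner_Integration.simple_bochner_integrable.cases)
  have space: "space ?L = S"
    by (simp add: space_restrict_space)
  have finite: "finite (s ` S)" and level: "{x\<in>S. s x = y} \<in> sets ?L" for y
    using s simple_functionD(2) [OF s, of "{y}"] simple_functionD(1) [OF s]
    by (auto simp: space vimage_def Int_def conj_commute)
  have part: "((\<lambda>x. indicat_real {x\<in>S. s x = y} x *\<^sub>R y) has_integral measure ?L {x\<in>S. s x = y} *\<^sub>R y) S"
    for y
  proof (cases "y = 0")
    case False
    have leb: "{x\<in>S. s x = y} \<in> sets lebesgue"
      using level [of y] assms(1) by (auto simp: sets_restrict_space_iff)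
    have "{x\<in>S. s x \<noteq> 0} \<in> sets ?L"
      using s simple_functionD(2) [OF s, of "- {0}"] by (auto simp: space vimage_def Int_def conj_commute)
    then have "emeasure ?L {x\<in>S. s x = y} \<le> emeasure ?L {x\<in>S. s x \<noteq> 0}"
      using False by (intro emeasure_mono) auto
    then have "emeasure ?L {x\<in>S. s x = y} < \<infinity>"
      using fin by (simp add: space less_top top_unique)
    then have "emeasure lebesgue {x\<in>S. s x = y} < \<infinity>"
      using assms(1) by (subst (asm) emeasure_restrict_space) auto
    then have "{x\<in>S. s x = y} \<in> lmeasurable"
      using leb by (simp add: fmeasurable_def)
    then have "(indicat_real {x\<in>S. s x = y} has_integral measure lebesgue {x\<in>S. s x = y}) UNIV"
      by (simp add: lmeasurable_iff_has_integral)
    then have "(indicat_real {x\<in>S. s x = y} has_integral measure lebesgue {x\<in>S. s x = y}) S"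
      by (subst has_integral_restrict_UNIV [symmetric], elim has_integral_eq [rotated]) auto
    moreover have "measure lebesgue {x\<in>S. s x = y} = measure ?L {x\<in>S. s x = y}"
      using assms(1) by (subst measure_restrict_space) auto
    ultimately show ?thesis
      using has_integral_linear [OF _ bounded_linear_scaleR_left, of "indicat_real {x\<in>S. s x = y}"]
      by (auto simp: o_def)
  qed simp
  have "((\<lambda>x. \<Sum>y\<in>s ` S. indicat_real {x\<in>S. s x = y} x *\<^sub>R y) has_integral
      (\<Sum>y\<in>s ` S. measure ?L {x\<in>S. s x = y} *\<^sub>R y)) S"
    using finite part by (intro has_integral_sum)
  moreover have "(\<Sum>y\<in>s ` S. indicat_real {x\<in>S. s x = y} x *\<^sub>R y) = s x" if "x \<in> S" for x
  proof -
    have "(\<Sum>y\<in>s ` S. indicat_real {x\<in>S. s x = y} x *\<^sub>R y) = (\<Sum>y\<in>s ` S. if y = s x then s x else 0)"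
      using that by (intro sum.cong) auto
    then show ?thesis
      using that finite by simp
  qed
  ultimately show ?thesis
    unfolding Bochner_Integration.simple_bochner_integral_def space by (rule has_integral_eq [rotated]) auto
qed

text \<open>
  The approximating simple functions are step functions: on \<open>{0..<i}\<close> the value at the next grid point to the
  left, for a grid so fine that uniform continuity keeps the error below \<open>e i\<close>, and \<open>0\<close> beyond.
  The error is then at most \<open>e i\<close> before \<open>i\<close> and an exponential tail after it. The choice
  \<open>e i = 1 / (i + 1)\<^sup>2\<close> makes the integral of this bound tend to \<open>0\<close> although the interval grows. The
  same bound controls the distance in mean, which is what the Bochner integral asks for, and the distance of
  the integral of the step function to the gauge integral.
\<close>

lemma exp_decaying_has_strong_bochner_integral:
  fixes f :: "real \<Rightarrow> 'a::banach"
  assumes "exp_decaying f"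
  shows "has_strong_bochner_integral (lebesgue_on {0..}) f (integral {0..} f)"
proof -
  let ?L = "lebesgue_on {0::real..}"
  from assms have cont: "continuous_on {0..} f"
    by (simp add: exp_decaying_def)
  from assms obtain K b where b: "0 < b" and K: "0 < K"
    and f: "\<And>t. 0 \<le> t \<Longrightarrow> norm (f t) \<le> K * exp (- b * t)"
    by (rule exp_decayingE) blast
  define e :: "nat \<Rightarrow> real" where "e i = 1 / (real i + 1)\<^sup>2" for i
  have e: "0 < e i" for i
    by (simp add: e_def)
  have "\<exists>d>0. \<forall>x\<in>{0..real i}. \<forall>y\<in>{0..real i}. dist y x < d \<longrightarrow> dist (f y) (f x) < e i" for i
    using compact_uniformly_continuous [OF continuous_on_subset [OF cont], of "{0..real i}"] e [of i]
    unfolding uniformly_continuous_on_def by (auto simp: Ball_def)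
  then obtain d where d: "\<And>i. 0 < d i"
    and fd: "\<And>i x y. x \<in> {0..real i} \<Longrightarrow> y \<in> {0..real i} \<Longrightarrow> dist y x < d i \<Longrightarrow> dist (f y) (f x) < e i"
    by metis
  \<comment> \<open>The step function factors through the index of the grid cell; the index \<open>- 1\<close> marks the points beyond \<open>i\<close>.\<close>
  define k :: "nat \<Rightarrow> real \<Rightarrow> int" where "k i t = (if t < real i then \<lfloor>t / d i\<rfloor> else - 1)" for i t
  define s where "s i t = (if k i t = - 1 then 0 else f (d i * of_int (k i t)))" for i t
  have grid: "0 \<le> d i * of_int \<lfloor>t / d i\<rfloor>" "d i * of_int \<lfloor>t / d i\<rfloor> \<le> t" "t < d i * of_int \<lfloor>t / d i\<rfloor> + d i"
    if "0 \<le> t" for i t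
  proof -
    have "d i * of_int \<lfloor>t / d i\<rfloor> \<le> d i * (t / d i)" "d i * (t / d i) < d i * (of_int \<lfloor>t / d i\<rfloor> + 1)"
      using d [of i] by (intro mult_left_mono mult_strict_left_mono; linarith)+
    then show "d i * of_int \<lfloor>t / d i\<rfloor> \<le> t" "t < d i * of_int \<lfloor>t / d i\<rfloor> + d i"
      using d [of i] by (simp_all add: distrib_left)
    show "0 \<le> d i * of_int \<lfloor>t / d i\<rfloor>"
      using d [of i] that by (intro mult_nonneg_nonneg) auto
  qed
  have s_less: "norm (f t - s i t) \<le> e i" if "0 \<le> t" "t < real i" for i t
  proof -
    have "0 \<le> \<lfloor>t / d i\<rfloor>"
      using d [of i] that by simp
    then have "\<lfloor>t / d i\<rfloor> \<noteq> - 1"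
      by linarith
    then have "s i t = f (d i * of_int \<lfloor>t / d i\<rfloor>)"
      using that by (simp add: s_def k_def)
    moreover have "dist (f t) (f (d i * of_int \<lfloor>t / d i\<rfloor>)) < e i"
      using grid [of t i] that by (intro fd) (auto simp: dist_real_def)
    ultimately show ?thesis
      by (simp add: dist_norm)
  qed
  have s_ge: "s i t = 0" if "real i \<le> t" for i t
    using that by (simp add: s_def k_def)
  have simple: "simple_function ?L (s i)" for i
  proof -
    have "k i t \<in> {- 1..\<lfloor>real i / d i\<rfloor>}" if "0 \<le> t" for t
    proof -
      have "0 \<le> \<lfloor>t / d i\<rfloor>" "0 \<le> \<lfloor>real i / d i\<rfloor>"
        using d [of i] that by simp_all
      moreover have "\<lfloor>t / d i\<rfloor> \<le> \<lfloor>real i / d i\<rfloor>" if "t < real i"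
        using d [of i] that by (intro floor_mono divide_right_mono) auto
      ultimately show ?thesis
        unfolding k_def atLeastAtMost_iff by (smt (verit))
    qed
    then have "k i ` {0..} \<subseteq> {- 1..\<lfloor>real i / d i\<rfloor>}"
      by auto
    then have "finite (k i ` {0..})"
      by (rule finite_subset) simp
    moreover have "k i \<in> borel \<rightarrow>\<^sub>M count_space UNIV"
      unfolding k_def by measurable
    then have "k i \<in> ?L \<rightarrow>\<^sub>M count_space UNIV"
      by (intro measurable_restrict_space1 measurable_completion) simp
    ultimately have "simple_function ?L (k i)"
      by (simp add: simple_function_eq_measurable space_restrict_space)
    then have "simple_function ?L ((\<lambda>j. if j = - 1 then 0 else f (d i * of_int j)) \<circ> k i)"
      by (rule simple_function_compose)
    then show ?thesis
      by (simp add: s_def [abs_def] o_def)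
  qed
  have simple_int: "Bochner_Integration.simple_bochner_integrable ?L (s i)" for i
  proof (rule Bochner_Integration.simple_bochner_integrable.intros [OF simple])
    have "t \<le> real i" if "s i t \<noteq> 0" for t
      using s_ge [of i t] that by linarith
    then have "emeasure ?L {t \<in> space ?L. s i t \<noteq> 0} \<le> emeasure ?L {0..real i}"
      by (intro emeasure_mono) (auto simp: space_restrict_space sets_restrict_space_iff)
    also have "\<dots> = ennreal (real i)"
      by (subst emeasure_restrict_space) auto
    finally show "emeasure ?L {t \<in> space ?L. s i t \<noteq> 0} \<noteq> \<infinity>"
      by (auto simp: top_unique)
  qed
  define h where "h i t = (if t \<in> {0..real i} then e i else 0) +
      (if t \<in> {real i..} then K * exp (- b * t) else 0)" for i t
  define H where "H i = e i * real i + K * (exp (- b * real i) / b)" for i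
  have bound: "norm (f t - s i t) \<le> h i t" if "0 \<le> t" for i t
    using that s_less [of t i] s_ge [of i t] f [of t] e [of i] K by (auto simp: h_def)
  have h: "(h i has_integral H i) {0..}" for i
  proof -
    have "((\<lambda>t. if t \<in> {0..real i} then e i else 0) has_integral e i * real i) {0..}"
      using has_integral_const_real [of "e i" 0 "real i"]
      by (subst has_integral_restrict) (auto simp: mult.commute)
    moreover have "((\<lambda>t. if t \<in> {real i..} then K * exp (- b * t) else 0) has_integral
        K * (exp (- b * real i) / b)) {0..}"
      using b by (intro has_integral_exp_tail) auto
    ultimately show ?thesis
      unfolding h_def H_def by (rule has_integral_add)
  qed
  have H: "H \<longlonglongrightarrow> 0"
    unfolding H_def e_def using b by real_asymp
  have h_nonneg: "0 \<le> h i t" for i t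
    using e [of i] K by (simp add: h_def)
  have nn: "(\<integral>\<^sup>+t. norm (f t - s i t) \<partial>?L) \<le> ennreal (H i)" for i
  proof -
    have "(\<integral>\<^sup>+t. norm (f t - s i t) \<partial>?L) \<le> (\<integral>\<^sup>+t. h i t \<partial>?L)"
      using bound by (intro nn_integral_mono ennreal_leI) (auto simp: space_restrict_space)
    also have "\<dots> = (\<integral>\<^sup>+t. ennreal (h i t) * indicator {0..} t \<partial>lborel)"
      by (subst nn_integral_restrict_space) (auto simp: nn_integral_completion)
    also have "\<dots> = ennreal (H i)"
      using h_nonneg h by (intro nn_integral_has_integral_lebesgue')
    finally show ?thesis .
  qed
  have approx: "norm (integral {0..} f - Bochner_Integration.simple_bochner_integral ?L (s i)) \<le> H i" for i
  proof -
    have "((\<lambda>t. f t - s i t) has_integral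
        integral {0..} f - Bochner_Integration.simple_bochner_integral ?L (s i)) {0..}"
      by (intro has_integral_diff integrable_integral exp_decaying_integrable assms
          simple_bochner_integral_has_integral simple_int) auto
    then show ?thesis
      using integral_norm_bound_integral [of "\<lambda>t. f t - s i t" "{0..}" "h i"] h [of i] bound
      by (auto simp: has_integral_iff)
  qed
  have "strongly_measurable ?L f"
    unfolding strongly_measurable_def
  proof (intro exI [of _ s] conjI allI simple AE_I2)
    fix t :: real assume "t \<in> space ?L"
    then have t: "0 \<le> t"
      by (simp add: space_restrict_space)
    have "(\<lambda>i. f t - s i t) \<longlonglongrightarrow> 0"
    proof (rule Lim_null_comparison)
      have "\<forall>\<^sub>F i in sequentially. t < real i"
        by real_asymp
      then show "\<forall>\<^sub>F i in sequentially. norm (f t - s i t) \<le> e i"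
        by eventually_elim (use t s_less in auto)
      show "e \<longlonglongrightarrow> 0"
        unfolding e_def by real_asymp
    qed
    from tendsto_diff [OF tendsto_const [of "f t"] this] show "(\<lambda>i. s i t) \<longlonglongrightarrow> f t"
      by simp
  qed
  moreover have "(\<lambda>i. \<integral>\<^sup>+t. norm (f t - s i t) \<partial>?L) \<longlonglongrightarrow> 0"
  proof (rule tendsto_sandwich [OF _ _ tendsto_const])
    show "\<forall>\<^sub>F i in sequentially. (\<integral>\<^sup>+t. norm (f t - s i t) \<partial>?L) \<le> ennreal (H i)"
      using nn by (intro always_eventually allI)
    show "(\<lambda>i. ennreal (H i)) \<longlonglongrightarrow> 0"
      using tendsto_ennrealI [OF H] by simp
  qed simp
  moreover have "(\<lambda>i. Bochner_Integration.simple_bochner_integral ?L (s i)) \<longlonglongrightarrow> integral {0..} f"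
  proof -
    have "(\<lambda>i. integral {0..} f - Bochner_Integration.simple_bochner_integral ?L (s i)) \<longlonglongrightarrow> 0"
      by (rule Lim_null_comparison [OF always_eventually H]) (use approx in blast)
    from tendsto_diff [OF tendsto_const [of "integral {0..} f"] this] show ?thesis
      by simp
  qed
  ultimately show ?thesis
    unfolding has_strong_bochner_integral_def using simple_int by blast
qed

section \<open>Weighted means of an exponentially bounded semigroup\<close>

locale exp_bounded_semigroup =
  fixes T :: "real \<Rightarrow> 'x::banach \<Rightarrow> 'x" and M \<omega> :: real
  assumes bounded_linear_T: "0 \<le> t \<Longrightarrow> bounded_linear (T t)"
    and T_zero: "T 0 x = x"
    and T_plus: "0 \<le> s \<Longrightarrow> 0 \<le> t \<Longrightarrow> T (s + t) x = T s (T t x)"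
    and continuous_T: "continuous_on {0..} (\<lambda>t. T t x)"
    and norm_T: "0 \<le> t \<Longrightarrow> norm (T t x) \<le> M * exp (\<omega> * t) * norm x"
begin

lemma M_nonneg: "0 \<le> M * norm (x :: 'x)"
  using order_trans [OF norm_ge_zero norm_T [of 0 x]] by (simp add: T_zero)

text \<open>
  The Hille-Phillips functional calculus: the operator attached to the Laplace transform of \<open>\<phi>\<close>.
\<close>

definition weighted_mean :: "(real \<Rightarrow> real) \<Rightarrow> 'x \<Rightarrow> 'x" where
  "weighted_mean \<phi> x = integral {0..} (\<lambda>t. \<phi> t *\<^sub>R T t x)"

lemma norm_weighted_le:
  assumes "0 \<le> t" "\<bar>c\<bar> \<le> K * exp (- b * t)"
  shows "norm (c *\<^sub>R T t x) \<le> K * (M * norm x) * exp (- (b - \<omega>) * t)"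
proof -
  have "norm (c *\<^sub>R T t x) \<le> (K * exp (- b * t)) * (M * exp (\<omega> * t) * norm x)"
    using norm_T [OF assms(1), of x] assms(2) by (auto intro!: mult_mono)
  also have "\<dots> = K * (M * norm x) * (exp (- b * t) * exp (\<omega> * t))"
    by (simp add: mult_ac)
  also have "exp (- b * t) * exp (\<omega> * t) = exp (- (b - \<omega>) * t)"
    by (simp add: exp_add [symmetric] algebra_simps)
  finally show ?thesis .
qed

lemma exp_decaying_weighted:
  assumes "continuous_on {0..} \<phi>" "\<omega> < b" "\<And>t. 0 \<le> t \<Longrightarrow> \<bar>\<phi> t\<bar> \<le> K * exp (- b * t)"
  shows "exp_decaying (\<lambda>t. \<phi> t *\<^sub>R T t x)"
proof (rule exp_decayingI)
  show "continuous_on {0..} (\<lambda>t. \<phi> t *\<^sub>R T t x)"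
    by (intro continuous_intros assms continuous_T)
  show "0 < b - \<omega>"
    using assms by simp
  show "norm (\<phi> t *\<^sub>R T t x) \<le> K * (M * norm x) * exp (- (b - \<omega>) * t)" if "0 \<le> t" for t
    using that assms by (intro norm_weighted_le) auto
qed

lemma integral_T_average: "((\<lambda>h. (1 / h) *\<^sub>R integral {0..h} (\<lambda>t. T t x)) \<longlongrightarrow> x) (at_right 0)"
proof -
  have "((\<lambda>u. integral {0..u} (\<lambda>t. T t x)) has_vector_derivative T 0 x) (at 0 within {0..1})"
    by (intro integral_has_vector_derivative continuous_on_subset [OF continuous_T]) auto
  then have "((\<lambda>h. (1 / norm (h - 0)) *\<^sub>R (integral {0..h} (\<lambda>t. T t x) -
      (integral {0..0} (\<lambda>t. T t x) + (h - 0) *\<^sub>R x))) \<longlongrightarrow> 0) (at_right 0)"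
    unfolding has_vector_derivative_def has_derivative_within by (simp add: at_within_Icc_at_right T_zero)
  moreover have "\<forall>\<^sub>F h in at_right (0::real). (1 / norm (h - 0)) *\<^sub>R (integral {0..h} (\<lambda>t. T t x) -
      (integral {0..0} (\<lambda>t. T t x) + (h - 0) *\<^sub>R x)) = (1 / h) *\<^sub>R integral {0..h} (\<lambda>t. T t x) - x"
    by (rule eventually_mono [OF eventually_at_right_less]) (simp add: scaleR_diff_right)
  ultimately have "((\<lambda>h. (1 / h) *\<^sub>R integral {0..h} (\<lambda>t. T t x) - x) \<longlongrightarrow> 0) (at_right 0)"
    by (rule Lim_transform_eventually)
  from tendsto_add [OF this tendsto_const [of x]] show ?thesis
    by simp
qed

text \<open>
  After the substitution \<open>t \<mapsto> t - h\<close>, the operator \<open>T h\<close> acts on the mean by shifting the weight: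
  \<open>T h (I \<phi> x)\<close> is the integral of \<open>\<phi> (t - h) *\<^sub>R T t x\<close> over \<open>{h..}\<close>. So the difference
  quotient is the mean of the difference quotient of \<open>\<phi>\<close>, which Taylor's formula compares with
  \<open>- \<phi>'\<close>, minus \<open>1 / h\<close> times the integral of \<open>\<phi> (t - h) *\<^sub>R T t x\<close> over \<open>{0..h}\<close>, which tends to
  \<open>\<phi> 0 *\<^sub>R x\<close>. The first comparison costs an error of order \<open>h\<close>, and so does replacing \<open>\<phi> (t - h)\<close> by
  \<open>\<phi> 0\<close> in the second integral. The shifted weight is evaluated at points of \<open>{- 1..}\<close>
  when \<open>h \<le> 1\<close>, hence the range of the bounds.
\<close>

lemma generator_weighted_mean:
  assumes \<phi>: "\<And>t. (\<phi> has_real_derivative \<phi>' t) (at t)"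
    and \<phi>': "\<And>t. (\<phi>' has_real_derivative \<phi>'' t) (at t)"
    and "\<omega> < b"
    and le: "\<And>t. - 1 \<le> t \<Longrightarrow> \<bar>\<phi> t\<bar> \<le> K * exp (- b * t)"
      "\<And>t. - 1 \<le> t \<Longrightarrow> \<bar>\<phi>' t\<bar> \<le> K * exp (- b * t)"
      "\<And>t. - 1 \<le> t \<Longrightarrow> \<bar>\<phi>'' t\<bar> \<le> K * exp (- b * t)"
  shows "((\<lambda>h. (1 / h) *\<^sub>R (T h (weighted_mean \<phi> x) - weighted_mean \<phi> x)) \<longlongrightarrow>
    - \<phi> 0 *\<^sub>R x - weighted_mean \<phi>' x) (at_right 0)"
proof -
  have cont: "continuous_on S \<phi>" "continuous_on S \<phi>'" for S
    by (auto intro!: continuous_at_imp_continuous_on DERIV_isCont \<phi> \<phi>')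
  have K: "0 \<le> K"
    using le(1) [of 0] by simp
  define L where "L = K * exp \<bar>b\<bar>"
  \<comment> \<open>Moving the argument by at most 1 changes the exponential bound by a constant factor.\<close>
  have near: "K * exp (- b * s) \<le> L * exp (- b * t)" if "\<bar>s - t\<bar> \<le> 1" for s t
  proof -
    have "- b * s \<le> \<bar>b\<bar> + - b * t"
      using mult_left_mono [OF that, of "\<bar>b\<bar>"] by (simp add: abs_mult [symmetric] algebra_simps abs_le_iff)
    then show ?thesis
      using K by (simp add: L_def exp_add [symmetric] mult.assoc mult_left_mono)
  qed
  let ?F = "\<lambda>h t. \<phi> (t - h) *\<^sub>R T t x"
  have decay: "exp_decaying (?F h)" if "0 \<le> h" "h \<le> 1" for h
  proof (rule exp_decaying_weighted [OF _ \<open>\<omega> < b\<close>])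
    show "continuous_on {0..} (\<lambda>t. \<phi> (t - h))"
      by (intro continuous_on_compose2 [OF cont(1) [of UNIV]] continuous_intros) auto
    show "\<bar>\<phi> (t - h)\<bar> \<le> L * exp (- b * t)" if "0 \<le> t" for t
      using le(1) [of "t - h"] near [of "t - h" t] that \<open>0 \<le> h\<close> \<open>h \<le> 1\<close> by auto
  qed
  have decay': "exp_decaying (\<lambda>t. \<phi>' t *\<^sub>R T t x)"
    by (rule exp_decaying_weighted [OF cont(2) \<open>\<omega> < b\<close>, where K = K]) (use le(2) in auto)
  define C where "C = L * (M * norm x) / (b - \<omega>)"
  define B where "B = L * exp \<bar>b\<bar> * (M * exp \<bar>\<omega>\<bar> * norm x)"
  have shift: "T h (weighted_mean \<phi> x) = integral {0..} (?F h) - integral {0..h} (?F h)"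
    if "0 \<le> h" "h \<le> 1" for h
  proof -
    have "T h (weighted_mean \<phi> x) = integral {0..} (T h \<circ> ?F 0)"
      unfolding weighted_mean_def
      using integral_linear [OF exp_decaying_integrable [OF decay [of 0]] bounded_linear_T [OF that(1)]] by simp
    also have "\<dots> = integral {0..} (\<lambda>t. ?F h (t + h))"
      using that by (intro Henstock_Kurzweil_Integration.integral_cong)
        (simp add: linear_cmul [OF bounded_linear.linear [OF bounded_linear_T]] T_plus [symmetric] add.commute)
    finally have *: "T h (weighted_mean \<phi> x) = integral {0..} (\<lambda>t. ?F h (t + h))" .
    have "exp_decaying (\<lambda>t. \<phi> t *\<^sub>R T t (T h x))"
      by (intro exp_decaying_weighted [OF cont(1) \<open>\<omega> < b\<close>, where K = K]) (use le(1) in auto)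
    then have "exp_decaying (\<lambda>t. ?F h (t + h))"
      by (subst exp_decaying_cong) (use that in \<open>auto simp: T_plus\<close>)
    from integral_half_line_shift [OF decay [OF that] this that(1)] * show ?thesis
      by simp
  qed
  have taylor: "\<bar>(1 / h) * (\<phi> (t - h) - \<phi> t) + \<phi>' t\<bar> \<le> (h * L) * exp (- b * t)"
    if h: "0 < h" "h \<le> 1" and "0 \<le> t" for h t
  proof -
    obtain s where s: "t - h < s" "s < t" "\<phi> t - \<phi> (t - h) = (t - (t - h)) * \<phi>' s"
      using MVT2 [of "t - h" t \<phi> \<phi>'] \<phi> h by auto
    obtain r where r: "s < r" "r < t" "\<phi>' t - \<phi>' s = (t - s) * \<phi>'' r"
      using MVT2 [of s t \<phi>' \<phi>''] \<phi>' s by auto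
    have "(1 / h) * (\<phi> (t - h) - \<phi> t) + \<phi>' t = (t - s) * \<phi>'' r"
      using s(3) r(3) h by (simp add: field_simps)
    moreover have "\<bar>(t - s) * \<phi>'' r\<bar> \<le> h * (L * exp (- b * t))"
      unfolding abs_mult
      using s r h that le(3) [of r] near [of r t] by (intro mult_mono) auto
    ultimately show ?thesis
      by simp
  qed
  have remainder: "norm (integral {0..} (\<lambda>t. ((1 / h) * (\<phi> (t - h) - \<phi> t) + \<phi>' t) *\<^sub>R T t x)) \<le> h * C"
    if h: "0 < h" "h \<le> 1" for h
  proof -
    have "norm (integral {0..} (\<lambda>t. ((1 / h) * (\<phi> (t - h) - \<phi> t) + \<phi>' t) *\<^sub>R T t x)) \<le>
        h * L * (M * norm x) / (b - \<omega>)"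
    proof (rule integral_half_line_norm_le)
      show "exp_decaying (\<lambda>t. ((1 / h) * (\<phi> (t - h) - \<phi> t) + \<phi>' t) *\<^sub>R T t x)"
        using taylor [OF h] h
        by (intro exp_decaying_weighted [OF _ \<open>\<omega> < b\<close>, where K = "h * L"])
          (auto intro!: continuous_intros cont continuous_on_compose2 [OF cont(1) [of UNIV]])
      show "norm (((1 / h) * (\<phi> (t - h) - \<phi> t) + \<phi>' t) *\<^sub>R T t x) \<le> h * L * (M * norm x) * exp (- (b - \<omega>) * t)"
        if "0 \<le> t" for t
        using that taylor [OF h] by (intro norm_weighted_le)
    qed (use \<open>\<omega> < b\<close> in simp)
    then show ?thesis
      by (simp add: C_def)
  qed
  have boundary: "norm ((1 / h) *\<^sub>R integral {0..h} (?F h) - \<phi> 0 *\<^sub>R ((1 / h) *\<^sub>R integral {0..h} (\<lambda>t. T t x))) \<le> h * B"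
    if h: "0 < h" "h \<le> 1" for h
  proof -
    have int: "?F h integrable_on {0..h}" "(\<lambda>t. T t x) integrable_on {0..h}"
      by (auto intro!: integrable_continuous_interval continuous_intros continuous_on_subset [OF continuous_T]
          continuous_on_compose2 [OF cont(1) [of UNIV]])
    have "norm (?F h t - \<phi> 0 *\<^sub>R T t x) \<le> h * B" if t: "t \<in> {0..h}" for t
    proof -
      have "\<bar>\<phi> (t - h) - \<phi> 0\<bar> \<le> h * (L * exp \<bar>b\<bar>)"
      proof (cases "t = h")
        case False
        then obtain s where s: "t - h < s" "s < 0" "\<phi> 0 - \<phi> (t - h) = (0 - (t - h)) * \<phi>' s"
          using MVT2 [of "t - h" 0 \<phi> \<phi>'] \<phi> t by auto
        then have "\<bar>\<phi> (t - h) - \<phi> 0\<bar> = (h - t) * \<bar>\<phi>' s\<bar>"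
          using t by (simp add: abs_minus_commute [of "\<phi> (t - h)"] abs_mult)
        moreover have "\<bar>\<phi>' s\<bar> \<le> L * exp \<bar>b\<bar>"
          using le(2) [of s] near [of s 0] s t h K order_trans [OF _ mult_left_mono [of 1 "exp \<bar>b\<bar>" L]]
          by (auto simp: L_def)
        ultimately show ?thesis
          using t by (auto intro!: mult_mono)
      qed (use h K in \<open>simp add: L_def\<close>)
      moreover have "norm (T t x) \<le> M * exp \<bar>\<omega>\<bar> * norm x"
      proof -
        have "\<omega> * t \<le> \<bar>\<omega>\<bar> * 1"
          using t h by (intro order_trans [OF mult_right_mono [of \<omega> "\<bar>\<omega>\<bar>" t] mult_left_mono]) auto
        then have "(M * norm x) * exp (\<omega> * t) \<le> (M * norm x) * exp \<bar>\<omega>\<bar>"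
          using M_nonneg by (intro mult_left_mono) auto
        then show ?thesis
          using norm_T [of t x] t by (simp add: mult_ac)
      qed
      ultimately have "\<bar>\<phi> (t - h) - \<phi> 0\<bar> * norm (T t x) \<le> (h * (L * exp \<bar>b\<bar>)) * (M * exp \<bar>\<omega>\<bar> * norm x)"
        using h K by (intro mult_mono) (auto simp: L_def)
      then show ?thesis
        by (simp add: B_def scaleR_diff_left [symmetric] mult.assoc)
    qed
    then have "norm (integral {0..h} (\<lambda>t. ?F h t - \<phi> 0 *\<^sub>R T t x)) \<le> integral {0..h} (\<lambda>t. h * B)"
      using int by (intro integral_norm_bound_integral integrable_diff integrable_cmul) auto
    then have "norm (integral {0..h} (?F h) - \<phi> 0 *\<^sub>R integral {0..h} (\<lambda>t. T t x)) \<le> h * (h * B)"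
      using int h by (simp add: integral_diff integrable_cmul)
    then have "(1 / h) * norm (integral {0..h} (?F h) - \<phi> 0 *\<^sub>R integral {0..h} (\<lambda>t. T t x)) \<le> h * B"
      using h by (simp add: field_simps)
    moreover have "(1 / h) *\<^sub>R integral {0..h} (?F h) - \<phi> 0 *\<^sub>R ((1 / h) *\<^sub>R integral {0..h} (\<lambda>t. T t x)) =
        (1 / h) *\<^sub>R (integral {0..h} (?F h) - \<phi> 0 *\<^sub>R integral {0..h} (\<lambda>t. T t x))"
      by (simp add: scaleR_diff_right)
    ultimately show ?thesis
      using h by simp
  qed
  \<comment> \<open>\<open>r h\<close> and \<open>q h\<close> are the errors in the interior and at the boundary.\<close>
  define r where "r h = integral {0..} (\<lambda>t. ((1 / h) * (\<phi> (t - h) - \<phi> t) + \<phi>' t) *\<^sub>R T t x)" for h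
  define q where "q h = (1 / h) *\<^sub>R integral {0..h} (?F h) - \<phi> 0 *\<^sub>R ((1 / h) *\<^sub>R integral {0..h} (\<lambda>t. T t x))" for h
  have decomp: "(1 / h) *\<^sub>R (T h (weighted_mean \<phi> x) - weighted_mean \<phi> x) =
      r h - weighted_mean \<phi>' x - q h - \<phi> 0 *\<^sub>R ((1 / h) *\<^sub>R integral {0..h} (\<lambda>t. T t x))"
    if h: "0 < h" "h \<le> 1" for h
  proof -
    have "r h = integral {0..} (\<lambda>t. (1 / h) *\<^sub>R (?F h t - ?F 0 t) + \<phi>' t *\<^sub>R T t x)"
      unfolding r_def by (simp add: scaleR_add_left scaleR_diff_left scaleR_diff_right diff_divide_distrib)
    also have "\<dots> = (1 / h) *\<^sub>R (integral {0..} (?F h) - integral {0..} (?F 0)) + weighted_mean \<phi>' x"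
      using exp_decaying_integrable [OF decay [of h]] exp_decaying_integrable [OF decay [of 0]]
        exp_decaying_integrable [OF decay'] h
      unfolding weighted_mean_def
      by (subst integral_add) (auto intro!: integrable_cmul integrable_diff simp: integral_diff)
    finally have "r h = (1 / h) *\<^sub>R (integral {0..} (?F h) - weighted_mean \<phi> x) + weighted_mean \<phi>' x"
      by (simp add: weighted_mean_def)
    then show ?thesis
      using shift [of h] h by (simp add: q_def scaleR_diff_right)
  qed
  have small: "\<forall>\<^sub>F h in at_right 0. 0 < h \<and> h \<le> (1::real)"
    unfolding eventually_at_right_field by (intro exI [of _ 1]) auto
  have "(r \<longlongrightarrow> 0) (at_right 0)"
  proof (rule Lim_null_comparison)
    show "\<forall>\<^sub>F h in at_right 0. norm (r h) \<le> h * C"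
      using small by eventually_elim (use remainder in \<open>auto simp: r_def\<close>)
    show "((\<lambda>h. h * C) \<longlongrightarrow> 0) (at_right 0)"
      by (auto intro!: tendsto_eq_intros)
  qed
  moreover have "(q \<longlongrightarrow> 0) (at_right 0)"
  proof (rule Lim_null_comparison)
    show "\<forall>\<^sub>F h in at_right 0. norm (q h) \<le> h * B"
      using small by eventually_elim (use boundary in \<open>auto simp: q_def\<close>)
    show "((\<lambda>h. h * B) \<longlongrightarrow> 0) (at_right 0)"
      by (auto intro!: tendsto_eq_intros)
  qed
  ultimately have "((\<lambda>h. r h - weighted_mean \<phi>' x - q h - \<phi> 0 *\<^sub>R ((1 / h) *\<^sub>R integral {0..h} (\<lambda>t. T t x)))
      \<longlongrightarrow> 0 - weighted_mean \<phi>' x - 0 - \<phi> 0 *\<^sub>R x) (at_right 0)"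
    by (intro tendsto_intros integral_T_average)
  moreover have "\<forall>\<^sub>F h in at_right 0. r h - weighted_mean \<phi>' x - q h -
      \<phi> 0 *\<^sub>R ((1 / h) *\<^sub>R integral {0..h} (\<lambda>t. T t x)) =
      (1 / h) *\<^sub>R (T h (weighted_mean \<phi> x) - weighted_mean \<phi> x)"
    using small by eventually_elim (rule decomp [symmetric], auto)
  ultimately have "((\<lambda>h. (1 / h) *\<^sub>R (T h (weighted_mean \<phi> x) - weighted_mean \<phi> x)) \<longlongrightarrow>
      0 - weighted_mean \<phi>' x - 0 - \<phi> 0 *\<^sub>R x) (at_right 0)"
    by (rule Lim_transform_eventually)
  moreover have "0 - weighted_mean \<phi>' x - 0 - \<phi> 0 *\<^sub>R x = - \<phi> 0 *\<^sub>R x - weighted_mean \<phi>' x"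
    by simp
  ultimately show ?thesis
    by (simp only:)
qed

end

lemma generator_eqI:
  assumes "((\<lambda>h. (1 / h) *\<^sub>R (T h x - x)) \<longlongrightarrow> y) (at_right 0)"
  shows "x \<in> generator_domain T" "generator T x = y"
  using assms tendsto_Lim [OF _ assms] by (auto simp: generator_domain_def generator_def)

lemma generator_tendsto:
  assumes "x \<in> generator_domain T"
  shows "((\<lambda>h. (1 / h) *\<^sub>R (T h x - x)) \<longlongrightarrow> generator T x) (at_right 0)"
  using assms generator_eqI(2) by (fastforce simp: generator_domain_def)

lemma power_domain_antimono: "k \<le> n \<Longrightarrow> power_domain D A n \<subseteq> power_domain D A k"
  by (induction n) (auto simp: le_Suc_eq)

context exp_bounded_semigroup
begin

lemma generator_scaleR:
  assumes "x \<in> generator_domain T"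
  shows "c *\<^sub>R x \<in> generator_domain T" "generator T (c *\<^sub>R x) = c *\<^sub>R generator T x"
proof -
  have "((\<lambda>h. c *\<^sub>R ((1 / h) *\<^sub>R (T h x - x))) \<longlongrightarrow> c *\<^sub>R generator T x) (at_right 0)"
    by (intro tendsto_intros generator_tendsto assms)
  moreover have "\<forall>\<^sub>F h in at_right 0. c *\<^sub>R ((1 / h) *\<^sub>R (T h x - x)) = (1 / h) *\<^sub>R (T h (c *\<^sub>R x) - c *\<^sub>R x)"
    by (rule eventually_mono [OF eventually_at_right_less])
      (simp add: linear_cmul [OF bounded_linear.linear [OF bounded_linear_T]] scaleR_diff_right)
  ultimately have "((\<lambda>h. (1 / h) *\<^sub>R (T h (c *\<^sub>R x) - c *\<^sub>R x)) \<longlongrightarrow> c *\<^sub>R generator T x) (at_right 0)"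
    by (rule Lim_transform_eventually)
  then show "c *\<^sub>R x \<in> generator_domain T" "generator T (c *\<^sub>R x) = c *\<^sub>R generator T x"
    by (rule generator_eqI)+
qed

lemma generator_power_scaleR:
  assumes "x \<in> power_domain (generator_domain T) (generator T) k"
  shows "c *\<^sub>R x \<in> power_domain (generator_domain T) (generator T) k"
    and "(generator T ^^ k) (c *\<^sub>R x) = c *\<^sub>R (generator T ^^ k) x"
  using assms by (induction k) (auto simp: generator_scaleR)

lemma bounded_linear_weighted_mean:
  assumes "continuous_on {0..} \<phi>" "\<omega> < b" and le: "\<And>t. 0 \<le> t \<Longrightarrow> \<bar>\<phi> t\<bar> \<le> K * exp (- b * t)"
  shows "bounded_linear (weighted_mean \<phi>)"
proof (rule bounded_linear_intro)
  have decay: "exp_decaying (\<lambda>t. \<phi> t *\<^sub>R T t x)" for x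
    using assms by (rule exp_decaying_weighted)
  note int = exp_decaying_integrable [OF decay]
  fix x y :: 'x and r :: real
  have "weighted_mean \<phi> (x + y) = integral {0..} (\<lambda>t. \<phi> t *\<^sub>R T t x + \<phi> t *\<^sub>R T t y)"
    unfolding weighted_mean_def
    by (intro Henstock_Kurzweil_Integration.integral_cong)
      (simp add: linear_add [OF bounded_linear.linear [OF bounded_linear_T]] scaleR_add_right)
  then show "weighted_mean \<phi> (x + y) = weighted_mean \<phi> x + weighted_mean \<phi> y"
    using int by (simp add: weighted_mean_def Henstock_Kurzweil_Integration.integral_add)
  have "weighted_mean \<phi> (r *\<^sub>R x) = integral {0..} (\<lambda>t. r *\<^sub>R (\<phi> t *\<^sub>R T t x))"
    unfolding weighted_mean_def
    by (intro Henstock_Kurzweil_Integration.integral_cong)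
      (simp add: linear_cmul [OF bounded_linear.linear [OF bounded_linear_T]] mult.commute)
  then show "weighted_mean \<phi> (r *\<^sub>R x) = r *\<^sub>R weighted_mean \<phi> x"
    by (simp only: weighted_mean_def Henstock_Kurzweil_Integration.integral_cmul)
  have "norm (weighted_mean \<phi> x) \<le> K * (M * norm x) / (b - \<omega>)"
    unfolding weighted_mean_def
    by (rule integral_half_line_norm_le [OF decay]) (use assms norm_weighted_le in auto)
  then show "norm (weighted_mean \<phi> x) \<le> norm x * (K * M / (b - \<omega>))"
    by (simp add: mult_ac)
qed

lemma T_weighted_mean_commute:
  assumes "exp_decaying (\<lambda>t. \<phi> t *\<^sub>R T t x)" "0 \<le> h"
  shows "T h (weighted_mean \<phi> x) = weighted_mean \<phi> (T h x)"
proof -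
  have "T h (weighted_mean \<phi> x) = integral {0..} (T h \<circ> (\<lambda>t. \<phi> t *\<^sub>R T t x))"
    unfolding weighted_mean_def
    using integral_linear [OF exp_decaying_integrable [OF assms(1)] bounded_linear_T [OF assms(2)]] by simp
  also have "\<dots> = weighted_mean \<phi> (T h x)"
    unfolding weighted_mean_def using assms(2)
    by (intro Henstock_Kurzweil_Integration.integral_cong)
      (simp add: linear_cmul [OF bounded_linear.linear [OF bounded_linear_T]] T_plus [symmetric] add.commute)
  finally show ?thesis .
qed

text \<open>
  A bounded operator that commutes with the semigroup commutes with its difference quotients, hence with
  their limit.
\<close>

lemma generator_weighted_mean_commute:
  assumes \<phi>: "continuous_on {0..} \<phi>" "\<omega> < b" "\<And>t. 0 \<le> t \<Longrightarrow> \<bar>\<phi> t\<bar> \<le> K * exp (- b * t)"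
    and x: "x \<in> generator_domain T"
  shows "generator T (weighted_mean \<phi> x) = weighted_mean \<phi> (generator T x)"
proof (rule generator_eqI(2))
  interpret wm: bounded_linear "weighted_mean \<phi>"
    using \<phi> by (rule bounded_linear_weighted_mean)
  have "((\<lambda>h. weighted_mean \<phi> ((1 / h) *\<^sub>R (T h x - x))) \<longlongrightarrow> weighted_mean \<phi> (generator T x)) (at_right 0)"
    by (intro wm.tendsto generator_tendsto x)
  moreover have "\<forall>\<^sub>F h in at_right 0. weighted_mean \<phi> ((1 / h) *\<^sub>R (T h x - x)) =
      (1 / h) *\<^sub>R (T h (weighted_mean \<phi> x) - weighted_mean \<phi> x)"
    by (rule eventually_mono [OF eventually_at_right_less])
      (simp add: wm.scaleR wm.diff T_weighted_mean_commute [OF exp_decaying_weighted [OF \<phi>]])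
  ultimately show "((\<lambda>h. (1 / h) *\<^sub>R (T h (weighted_mean \<phi> x) - weighted_mean \<phi> x)) \<longlongrightarrow>
      weighted_mean \<phi> (generator T x)) (at_right 0)"
    by (rule Lim_transform_eventually)
qed

end

context exp_bounded_semigroup
begin

text \<open>
  The weights that occur are dominated by sums of \<open>t ^ k / fact k * exp (- r * t)\<close>; against the growth
  \<open>exp (\<omega> * t)\<close> of the semigroup, each summand contributes \<open>1 / (r - \<omega>) ^ (k + 1)\<close>.
\<close>

lemma norm_weighted_mean_le:
  fixes c :: "'i \<Rightarrow> real" and k :: "'i \<Rightarrow> nat"
  assumes "finite I" and c: "\<And>i. i \<in> I \<Longrightarrow> 0 \<le> c i" and "\<omega> < r"
    and decay: "exp_decaying (\<lambda>t. \<phi> t *\<^sub>R T t x)"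
    and le: "\<And>t. 0 \<le> t \<Longrightarrow> \<bar>\<phi> t\<bar> \<le> (\<Sum>i\<in>I. c i * (t ^ k i / fact (k i) * exp (- r * t)))"
  shows "norm (weighted_mean \<phi> x) \<le> M * (\<Sum>i\<in>I. c i / (r - \<omega>) ^ Suc (k i)) * norm x"
proof -
  let ?e = "\<lambda>k t. t ^ k / fact k * exp (- (r - \<omega>) * t)"
  let ?h = "\<lambda>t. (\<Sum>i\<in>I. c i * ?e (k i) t) * (M * norm x)"
  have int: "?e k integrable_on {0..}" for k
    using \<open>\<omega> < r\<close> by (intro exp_decaying_integrable exp_decaying_power_exp) simp
  have e: "integral {0..} (?e k) \<le> 1 / (r - \<omega>) ^ Suc k" for k
  proof (rule tendsto_upperbound)
    show "((\<lambda>N. integral {0..N} (?e k)) \<longlongrightarrow> integral {0..} (?e k)) at_top"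
      using \<open>\<omega> < r\<close> by (intro integral_half_line_tendsto exp_decaying_power_exp) simp
    show "\<forall>\<^sub>F N in at_top. integral {0..N} (?e k) \<le> 1 / (r - \<omega>) ^ Suc k"
      using eventually_ge_at_top [of 0] by eventually_elim (rule integral_power_exp_le, use \<open>\<omega> < r\<close> in auto)
  qed simp
  have h: "(?h has_integral (\<Sum>i\<in>I. c i * integral {0..} (?e (k i))) * (M * norm x)) {0..}"
    using \<open>finite I\<close> int
    by (intro has_integral_mult_left has_integral_sum has_integral_mult_right integrable_integral)
  have "norm (\<phi> t *\<^sub>R T t x) \<le> ?h t" if "t \<in> {0..}" for t
  proof -
    let ?s = "\<Sum>i\<in>I. c i * (t ^ k i / fact (k i) * exp (- r * t))"
    have "\<bar>\<phi> t\<bar> * norm (T t x) \<le> ?s * (M * exp (\<omega> * t) * norm x)"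
      using that le [of t] norm_T [of t x] by (intro mult_mono) (auto intro: order_trans [OF abs_ge_zero])
    also have "\<dots> = ?s * exp (\<omega> * t) * (M * norm x)"
      by (simp add: mult_ac)
    also have "?s * exp (\<omega> * t) = (\<Sum>i\<in>I. c i * (t ^ k i / fact (k i) * (exp (- r * t) * exp (\<omega> * t))))"
      unfolding sum_distrib_right by (simp only: mult.assoc)
    also have "exp (- r * t) * exp (\<omega> * t) = exp (- (r - \<omega>) * t)"
      by (simp add: exp_add [symmetric] algebra_simps)
    finally show ?thesis
      by simp
  qed
  then have "norm (weighted_mean \<phi> x) \<le> integral {0..} ?h"
    unfolding weighted_mean_def
    using exp_decaying_integrable [OF decay] h by (intro integral_norm_bound_integral) auto
  also have "\<dots> = (\<Sum>i\<in>I. c i * integral {0..} (?e (k i))) * (M * norm x)"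
    using h by (rule integral_unique)
  also have "\<dots> \<le> (\<Sum>i\<in>I. c i * (1 / (r - \<omega>) ^ Suc (k i))) * (M * norm x)"
    using e c M_nonneg by (intro mult_right_mono sum_mono mult_left_mono) auto
  finally show ?thesis
    by (simp add: mult_ac)
qed

end

section \<open>Inverting a polynomial of the generator\<close>

text \<open>
  \<open>\<phi> j\<close> stands for the \<open>j\<close>-th derivative of the kernel \<open>\<phi> 0\<close>, and \<open>Suc n\<close> is the degree of \<open>P\<close>. The
  sequence is carried along because all derivatives of the kernel serve as weights. The value
  of \<open>\<phi> n\<close> at \<open>0\<close> normalises the only boundary term that survives.
\<close>

locale semigroup_kernel = exp_bounded_semigroup T M \<omega>
  for T :: "real \<Rightarrow> 'x::banach \<Rightarrow> 'x" and M \<omega> :: real +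
  fixes \<phi> :: "nat \<Rightarrow> real \<Rightarrow> real" and n :: nat and P :: "real poly" and b :: real
  assumes kernel_deriv: "(\<phi> j has_real_derivative \<phi> (Suc j) t) (at t)"
    and kernel_bound: "\<exists>K. \<forall>t\<ge>- 1. \<bar>\<phi> j t\<bar> \<le> K * exp (- b * t)"
    and less_b: "\<omega> < b"
    and deg: "degree P = Suc n"
    and kernel_0: "j < n \<Longrightarrow> \<phi> j 0 = 0"
    and kernel_n: "(- 1) ^ Suc n * lead_coeff P * \<phi> n 0 = 1"
    and kernel_ode: "0 \<le> t \<Longrightarrow> (\<Sum>k\<le>Suc n. (- 1) ^ k * coeff P k * \<phi> k t) = 0"
begin

abbreviation "A \<equiv> generator T"
abbreviation "D \<equiv> generator_domain T"

lemma kernel_continuous: "continuous_on S (\<phi> j)"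
  by (intro continuous_at_imp_continuous_on ballI DERIV_isCont [OF kernel_deriv])

lemma bounded_linear_kernel_mean: "bounded_linear (weighted_mean (\<phi> j))"
proof -
  obtain K where "\<forall>t\<ge>- 1. \<bar>\<phi> j t\<bar> \<le> K * exp (- b * t)"
    using kernel_bound by blast
  then show ?thesis
    by (intro bounded_linear_weighted_mean [OF kernel_continuous less_b, where K = K]) auto
qed

lemma exp_decaying_kernel: "exp_decaying (\<lambda>t. \<phi> j t *\<^sub>R T t x)"
proof -
  obtain K where "\<forall>t\<ge>- 1. \<bar>\<phi> j t\<bar> \<le> K * exp (- b * t)"
    using kernel_bound by blast
  then show ?thesis
    by (intro exp_decaying_weighted [OF kernel_continuous less_b, where K = K]) auto
qed

lemma generator_kernel_commute:
  assumes "x \<in> D"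
  shows "A (weighted_mean (\<phi> j) x) = weighted_mean (\<phi> j) (A x)"
proof -
  obtain K where "\<forall>t\<ge>- 1. \<bar>\<phi> j t\<bar> \<le> K * exp (- b * t)"
    using kernel_bound by blast
  then show ?thesis
    by (intro generator_weighted_mean_commute [OF kernel_continuous less_b _ assms, where K = K]) auto
qed

lemma generator_kernel_mean:
  "weighted_mean (\<phi> j) x \<in> D" "A (weighted_mean (\<phi> j) x) = - \<phi> j 0 *\<^sub>R x - weighted_mean (\<phi> (Suc j)) x"
proof -
  obtain K0 K1 K2 where K: "\<And>t. t \<ge> - 1 \<Longrightarrow> \<bar>\<phi> j t\<bar> \<le> K0 * exp (- b * t)"
    "\<And>t. t \<ge> - 1 \<Longrightarrow> \<bar>\<phi> (Suc j) t\<bar> \<le> K1 * exp (- b * t)"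
    "\<And>t. t \<ge> - 1 \<Longrightarrow> \<bar>\<phi> (Suc (Suc j)) t\<bar> \<le> K2 * exp (- b * t)"
    using kernel_bound by meson
  define K where "K = max K0 (max K1 K2)"
  have le: "\<bar>c\<bar> \<le> K * exp (- b * t)" if "\<bar>c\<bar> \<le> K' * exp (- b * t)" "K' \<in> {K0, K1, K2}" for c t K'
  proof -
    have "K' * exp (- b * t) \<le> K * exp (- b * t)"
      using that(2) by (intro mult_right_mono) (auto simp: K_def)
    with that(1) show ?thesis
      by (rule order_trans)
  qed
  have "((\<lambda>h. (1 / h) *\<^sub>R (T h (weighted_mean (\<phi> j) x) - weighted_mean (\<phi> j) x)) \<longlongrightarrow>
      - \<phi> j 0 *\<^sub>R x - weighted_mean (\<phi> (Suc j)) x) (at_right 0)"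
  proof (rule generator_weighted_mean [OF kernel_deriv kernel_deriv less_b, where K = K])
    fix t :: real assume "- 1 \<le> t"
    then show "\<bar>\<phi> j t\<bar> \<le> K * exp (- b * t)" "\<bar>\<phi> (Suc j) t\<bar> \<le> K * exp (- b * t)"
        "\<bar>\<phi> (Suc (Suc j)) t\<bar> \<le> K * exp (- b * t)"
      by (rule le [OF K(1)] le [OF K(2)] le [OF K(3)]; simp)+
  qed
  then show "weighted_mean (\<phi> j) x \<in> D"
      "A (weighted_mean (\<phi> j) x) = - \<phi> j 0 *\<^sub>R x - weighted_mean (\<phi> (Suc j)) x"
    by (rule generator_eqI)+
qed

text \<open>
  Each application of the generator differentiates the kernel and changes the sign; the
  boundary terms vanish as long as the initial values do.
\<close>

lemma generator_power_kernel_mean: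
  assumes "k \<le> n"
  shows "weighted_mean (\<phi> 0) x \<in> power_domain D A (Suc k)"
    and "(A ^^ k) (weighted_mean (\<phi> 0) x) = (- 1) ^ k *\<^sub>R weighted_mean (\<phi> k) x"
proof -
  let ?y = "weighted_mean (\<phi> 0) x"
  have "?y \<in> power_domain D A (Suc k) \<and> (A ^^ k) ?y = (- 1) ^ k *\<^sub>R weighted_mean (\<phi> k) x"
    using assms
  proof (induction k)
    case 0
    then show ?case
      by (simp add: generator_kernel_mean)
  next
    case (Suc k)
    have "?y \<in> power_domain D A (Suc k) \<and> (A ^^ k) ?y = (- 1) ^ k *\<^sub>R weighted_mean (\<phi> k) x"
      using Suc.prems by (intro Suc.IH) simp
    then have IH: "?y \<in> power_domain D A (Suc k)" "(A ^^ k) ?y = (- 1) ^ k *\<^sub>R weighted_mean (\<phi> k) x"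
      by blast+
    have "(A ^^ Suc k) ?y = A ((- 1) ^ k *\<^sub>R weighted_mean (\<phi> k) x)"
      using IH(2) by simp
    also have "\<dots> = (- 1) ^ k *\<^sub>R A (weighted_mean (\<phi> k) x)"
      by (rule generator_scaleR(2) [OF generator_kernel_mean(1)])
    also have "\<dots> = (- 1) ^ Suc k *\<^sub>R weighted_mean (\<phi> (Suc k)) x"
      using Suc.prems by (simp add: generator_kernel_mean(2) kernel_0)
    finally have power: "(A ^^ Suc k) ?y = (- 1) ^ Suc k *\<^sub>R weighted_mean (\<phi> (Suc k)) x" .
    have "(A ^^ Suc k) ?y \<in> D"
      unfolding power by (rule generator_scaleR(1) [OF generator_kernel_mean(1)])
    with IH(1) power show ?case
      by (simp del: funpow.simps)
  qed
  then show "?y \<in> power_domain D A (Suc k)" "(A ^^ k) ?y = (- 1) ^ k *\<^sub>R weighted_mean (\<phi> k) x"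
    by blast+
qed

lemma generator_power_top_kernel_mean:
  "(A ^^ Suc n) (weighted_mean (\<phi> 0) x) = (- 1) ^ Suc n *\<^sub>R (\<phi> n 0 *\<^sub>R x + weighted_mean (\<phi> (Suc n)) x)"
proof -
  have "(A ^^ Suc n) (weighted_mean (\<phi> 0) x) = A ((- 1) ^ n *\<^sub>R weighted_mean (\<phi> n) x)"
    using generator_power_kernel_mean(2) [OF order_refl] by simp
  also have "\<dots> = (- 1) ^ n *\<^sub>R A (weighted_mean (\<phi> n) x)"
    by (rule generator_scaleR(2) [OF generator_kernel_mean(1)])
  also have "\<dots> = (- 1) ^ Suc n *\<^sub>R (\<phi> n 0 *\<^sub>R x + weighted_mean (\<phi> (Suc n)) x)"
    unfolding generator_kernel_mean(2) by (simp add: algebra_simps)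
  finally show ?thesis .
qed

text \<open>
  The integrals of the summands recombine to the integral of the differential equation, which is \<open>0\<close>; what
  remains is the boundary term of the leading power.
\<close>

lemma poly_operator_kernel_mean: "poly_operator P A (weighted_mean (\<phi> 0) x) = x"
proof -
  let ?y = "weighted_mean (\<phi> 0) x"
  have dom: "?y \<in> power_domain D A k" if "k \<le> Suc n" for k
    by (rule subsetD [OF power_domain_antimono [OF that] generator_power_kernel_mean(1) [OF order_refl]])
  have "poly_operator P A ?y = (\<Sum>k\<le>Suc n. coeff P k *\<^sub>R (A ^^ k) ?y)"
    unfolding poly_operator_def deg by (intro sum.cong refl) (simp add: generator_power_scaleR [OF dom])
  also have "\<dots> = (\<Sum>k\<le>n. coeff P k *\<^sub>R (A ^^ k) ?y) + coeff P (Suc n) *\<^sub>R (A ^^ Suc n) ?y"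
    by simp
  also have "(\<Sum>k\<le>n. coeff P k *\<^sub>R (A ^^ k) ?y) = (\<Sum>k\<le>n. ((- 1) ^ k * coeff P k) *\<^sub>R weighted_mean (\<phi> k) x)"
    by (intro sum.cong refl) (simp add: generator_power_kernel_mean(2) mult.commute)
  also have "\<dots> + coeff P (Suc n) *\<^sub>R (A ^^ Suc n) ?y =
      (\<Sum>k\<le>Suc n. ((- 1) ^ k * coeff P k) *\<^sub>R weighted_mean (\<phi> k) x) + ((- 1) ^ Suc n * coeff P (Suc n) * \<phi> n 0) *\<^sub>R x"
    unfolding generator_power_top_kernel_mean by (simp add: algebra_simps)
  also have "(- 1) ^ Suc n * coeff P (Suc n) * \<phi> n 0 = 1"
    using kernel_n deg by simp
  also have "(\<Sum>k\<le>Suc n. ((- 1) ^ k * coeff P k) *\<^sub>R weighted_mean (\<phi> k) x) =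
      integral {0..} (\<lambda>t. \<Sum>k\<le>Suc n. ((- 1) ^ k * coeff P k) *\<^sub>R (\<phi> k t *\<^sub>R T t x))"
    unfolding weighted_mean_def
    by (subst integral_sum, rule finite_atMost, intro integrable_cmul exp_decaying_integrable [OF exp_decaying_kernel],
        simp only: Henstock_Kurzweil_Integration.integral_cmul)
  also have "\<dots> = integral {0..} (\<lambda>t::real. 0)"
  proof (rule Henstock_Kurzweil_Integration.integral_cong)
    fix t :: real assume "t \<in> {0..}"
    then show "(\<Sum>k\<le>Suc n. ((- 1) ^ k * coeff P k) *\<^sub>R (\<phi> k t *\<^sub>R T t x)) = 0"
      using kernel_ode [of t] by (simp add: scaleR_sum_left [symmetric] del: sum.atMost_Suc)
  qed
  finally show ?thesis
    by simp
qed

lemma generator_power_kernel_commute: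
  assumes "x \<in> power_domain D A k"
  shows "(A ^^ k) (weighted_mean (\<phi> 0) x) = weighted_mean (\<phi> 0) ((A ^^ k) x)"
  using assms by (induction k) (auto simp: generator_kernel_commute)

text \<open>
  The mean commutes with the powers of the generator on their domains, so this follows from the right inverse.
\<close>

lemma kernel_mean_poly_operator:
  assumes "x \<in> power_domain D A (Suc n)"
  shows "weighted_mean (\<phi> 0) (poly_operator P A x) = x"
proof -
  interpret wm: bounded_linear "weighted_mean (\<phi> 0)"
    by (rule bounded_linear_kernel_mean)
  have dom: "x \<in> power_domain D A k" "weighted_mean (\<phi> 0) x \<in> power_domain D A k" if "k \<le> Suc n" for k
    by (rule subsetD [OF power_domain_antimono [OF that]], fact assms,
        rule subsetD [OF power_domain_antimono [OF that]], rule generator_power_kernel_mean(1) [OF order_refl])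
  have "weighted_mean (\<phi> 0) (poly_operator P A x) = poly_operator P A (weighted_mean (\<phi> 0) x)"
    unfolding poly_operator_def deg wm.sum
    by (intro sum.cong refl)
      (simp add: generator_power_scaleR [OF dom(1)] generator_power_scaleR [OF dom(2)] wm.scaleR
        generator_power_kernel_commute [OF dom(1)])
  then show ?thesis
    by (simp add: poly_operator_kernel_mean)
qed

lemma bij_betw_poly_operator: "bij_betw (poly_operator P A) (power_domain D A (Suc n)) UNIV"
proof (rule bij_betw_byWitness [where f' = "weighted_mean (\<phi> 0)"])
  show "weighted_mean (\<phi> 0) ` UNIV \<subseteq> power_domain D A (Suc n)"
    by (intro image_subsetI generator_power_kernel_mean(1) order_refl)
qed (simp_all add: kernel_mean_poly_operator poly_operator_kernel_mean del: power_domain.simps)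

lemma the_inv_poly_operator:
  "the_inv_into (power_domain D A (Suc n)) (poly_operator P A) = weighted_mean (\<phi> 0)"
proof
  fix x
  show "the_inv_into (power_domain D A (Suc n)) (poly_operator P A) x = weighted_mean (\<phi> 0) x"
    by (rule the_inv_into_f_eq [OF bij_betw_imp_inj_on [OF bij_betw_poly_operator]
          poly_operator_kernel_mean generator_power_kernel_mean(1) [OF order_refl]])
qed

end

section \<open>Residues and exponential polynomials\<close>

text \<open>
  The residue at infinity. On a large circle \<open>f z\<close> differs from \<open>c / z\<close> by at most
  \<open>e / R\<close>, while the circle has length \<open>2 * pi * R\<close>; so the contour integral of \<open>f\<close> is as close to
  \<open>2 * pi * \<i> * c\<close> as desired, and it equals \<open>2 * pi * \<i>\<close> times the sum of the residues.
\<close>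

lemma sum_residues_eq_limit_at_infinity:
  assumes S: "finite S" and f: "f holomorphic_on - S"
    and lim: "((\<lambda>z. z * f z) \<longlongrightarrow> c) at_infinity"
  shows "(\<Sum>s\<in>S. residue f s) = c"
proof -
  let ?s = "\<Sum>s\<in>S. residue f s"
  have "norm (?s - c) \<le> e" if "0 < e" for e
  proof -
    have "\<forall>\<^sub>F z in at_infinity. dist (z * f z) c < e"
      using lim that by (rule tendstoD)
    then obtain B where B: "\<And>z. B \<le> norm z \<Longrightarrow> dist (z * f z) c < e"
      unfolding eventually_at_infinity by blast
    obtain C where C: "\<And>s. s \<in> S \<Longrightarrow> norm s \<le> C"
      using finite_imp_bounded [OF S] unfolding bounded_iff by blast
    define R where "R = max 1 (max B (C + 1))"
    have R: "0 < R" "B \<le> R" "C < R"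
      by (auto simp: R_def)
    let ?\<gamma> = "circlepath 0 R"
    have path: "path_image ?\<gamma> \<subseteq> - S"
    proof
      fix z assume "z \<in> path_image ?\<gamma>"
      then have "norm z = R"
        using R by (simp add: path_image_circlepath)
      then show "z \<in> - S"
        using C [of z] R by auto
    qed
    have "f contour_integrable_on ?\<gamma>"
      using path by (intro contour_integrable_continuous_circlepath holomorphic_on_imp_continuous_on
          holomorphic_on_subset [OF f])
    moreover have "contour_integral ?\<gamma> f = 2 * pi * \<i> * ?s"
    proof -
      have "contour_integral ?\<gamma> f = 2 * pi * \<i> * (\<Sum>s\<in>S. winding_number ?\<gamma> s * residue f s)"
        using S f path by (intro Residue_theorem [of UNIV]) (auto simp: Compl_eq_Diff_UNIV)
      also have "(\<Sum>s\<in>S. winding_number ?\<gamma> s * residue f s) = ?s"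
        using C R by (intro sum.cong refl) (force simp: winding_number_circlepath)
      finally show ?thesis .
    qed
    ultimately have "(f has_contour_integral 2 * pi * \<i> * ?s) ?\<gamma>"
      by (metis has_contour_integral_integral)
    moreover have "((\<lambda>z. c / (z - 0)) has_contour_integral 2 * pi * \<i> * c) ?\<gamma>"
      using Cauchy_integral_circlepath_simple [of "\<lambda>_. c" 0 R 0] R by simp
    ultimately have "((\<lambda>z. f z - c / (z - 0)) has_contour_integral 2 * pi * \<i> * ?s - 2 * pi * \<i> * c) ?\<gamma>"
      by (rule has_contour_integral_diff)
    then have "norm (2 * pi * \<i> * ?s - 2 * pi * \<i> * c) \<le> e / R * (2 * pi * R)"
    proof (rule has_contour_integral_bound_circlepath)
      fix z :: complex assume z: "norm (z - 0) = R"
      then have "f z - c / (z - 0) = (z * f z - c) / z"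
        using R by (auto simp: field_simps)
      then have "norm (f z - c / (z - 0)) = norm (z * f z - c) / R"
        using z by (simp add: norm_divide)
      also have "\<dots> \<le> e / R"
        using R B [of z] z by (intro divide_right_mono) (auto simp: dist_norm)
      finally show "norm (f z - c / (z - 0)) \<le> e / R" .
    qed (use R that in auto)
    also have "norm (2 * pi * \<i> * ?s - 2 * pi * \<i> * c) = 2 * pi * norm (?s - c)"
      unfolding right_diff_distrib [symmetric] norm_mult by simp
    finally show ?thesis
      using R by simp
  qed
  then show ?thesis
    using field_le_epsilon [of "norm (?s - c)" 0] by auto
qed

text \<open>
  The coefficient of \<open>(z + \<mu>) ^ (- (k + 1))\<close> in the Laurent expansion of \<open>N(z) / p(- z)\<close> at \<open>- \<mu>\<close>. The
  numerator \<open>N\<close> is a parameter because differentiation of the inverse Laplace transform acts on it.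
\<close>

definition principal_coeff :: "complex poly \<Rightarrow> complex poly \<Rightarrow> complex \<Rightarrow> nat \<Rightarrow> complex" where
  "principal_coeff p N \<mu> k = residue (\<lambda>z. poly N z * (z + \<mu>) ^ k / poly p (- z)) (- \<mu>)"

text \<open>
  The sum of the residues of \<open>exp (t z) N(z) / p(- z)\<close>, with the residue at \<open>- \<mu>\<close> computed from the expansion
  of \<open>exp (t z)\<close> in powers of \<open>z + \<mu>\<close>.
\<close>

definition inverse_laplace :: "complex poly \<Rightarrow> complex poly \<Rightarrow> real \<Rightarrow> complex" where
  "inverse_laplace p N t = (\<Sum>\<mu>\<in>{z. poly p z = 0}. \<Sum>k<order \<mu> p.
     principal_coeff p N \<mu> k * (of_real t ^ k / fact k) * exp (- \<mu> * of_real t))"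

lemma isolated_root:
  fixes p :: "complex poly"
  assumes "p \<noteq> 0"
  obtains S where "open S" "- \<mu> \<in> S" "\<And>z. z \<in> S \<Longrightarrow> z \<noteq> - \<mu> \<Longrightarrow> poly p (- z) \<noteq> 0"
proof
  let ?Z = "uminus ` ({z. poly p z = 0} - {\<mu>})"
  show "open (- ?Z)"
    using poly_roots_finite [OF assms] by (intro open_Compl finite_imp_closed finite_imageI) auto
  show "- \<mu> \<in> - ?Z"
    by auto
  show "poly p (- z) \<noteq> 0" if "z \<in> - ?Z" "z \<noteq> - \<mu>" for z
  proof
    assume "poly p (- z) = 0"
    then have "- (- z) \<in> ?Z"
      using that(2) by (intro imageI) auto
    with that(1) show False
      by simp
  qed
qed

lemma principal_coeff_add:
  assumes "p \<noteq> 0"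
  shows "principal_coeff p (N + N') \<mu> k = principal_coeff p N \<mu> k + principal_coeff p N' \<mu> k"
proof -
  obtain S where S: "open S" "- \<mu> \<in> S" "\<And>z. z \<in> S \<Longrightarrow> z \<noteq> - \<mu> \<Longrightarrow> poly p (- z) \<noteq> 0"
    using isolated_root [OF assms] by blast
  have "residue (\<lambda>z. poly N z * (z + \<mu>) ^ k / poly p (- z) + poly N' z * (z + \<mu>) ^ k / poly p (- z)) (- \<mu>) =
      principal_coeff p N \<mu> k + principal_coeff p N' \<mu> k"
    unfolding principal_coeff_def using S by (intro residue_add) (auto intro!: holomorphic_intros)
  then show ?thesis
    by (simp add: principal_coeff_def add_divide_distrib distrib_right)
qed

lemma principal_coeff_smult:
  assumes "p \<noteq> 0"
  shows "principal_coeff p (smult c N) \<mu> k = c * principal_coeff p N \<mu> k"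
proof -
  obtain S where S: "open S" "- \<mu> \<in> S" "\<And>z. z \<in> S \<Longrightarrow> z \<noteq> - \<mu> \<Longrightarrow> poly p (- z) \<noteq> 0"
    using isolated_root [OF assms] by blast
  have "residue (\<lambda>z. c * (poly N z * (z + \<mu>) ^ k / poly p (- z))) (- \<mu>) = c * principal_coeff p N \<mu> k"
    unfolding principal_coeff_def using S by (intro residue_lmul) (auto intro!: holomorphic_intros)
  then show ?thesis
    by (simp add: principal_coeff_def mult.assoc)
qed

lemma principal_coeff_times_shift:
  "principal_coeff p ([:\<mu>, 1:] * N) \<mu> k = principal_coeff p N \<mu> (Suc k)"
  unfolding principal_coeff_def by (simp add: algebra_simps)

text \<open>
  Writing \<open>z = - \<mu> + (z + \<mu>)\<close> shows that multiplication of the numerator by \<open>z\<close> acts on the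
  coefficients as differentiation acts on the functions \<open>t ^ k / fact k * exp (- \<mu> * t)\<close>.
\<close>

lemma principal_coeff_times_X:
  assumes "p \<noteq> 0"
  shows "principal_coeff p ([:0, 1:] * N) \<mu> k = - \<mu> * principal_coeff p N \<mu> k + principal_coeff p N \<mu> (Suc k)"
proof -
  have "[:0, 1:] * N = smult (- \<mu>) N + [:\<mu>, 1:] * N"
    by (simp add: algebra_simps)
  then show ?thesis
    by (simp only: principal_coeff_add [OF assms] principal_coeff_smult [OF assms] principal_coeff_times_shift)
qed

text \<open>
  The order of the pole at \<open>- \<mu>\<close> is at most the order of the root \<open>\<mu>\<close>, so a factor \<open>(z + \<mu>) ^ k\<close>
  removes it.
\<close>

lemma principal_coeff_eq_0:
  assumes "p \<noteq> 0" "order \<mu> p \<le> k"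
  shows "principal_coeff p N \<mu> k = 0"
proof -
  obtain S where S: "open S" "- \<mu> \<in> S" "\<And>z. z \<in> S \<Longrightarrow> z \<noteq> - \<mu> \<Longrightarrow> poly p (- z) \<noteq> 0"
    using isolated_root [OF assms(1)] by blast
  obtain q where p: "p = [:- \<mu>, 1:] ^ order \<mu> p * q" and "\<not> [:- \<mu>, 1:] dvd q"
    using order_decomp [OF assms(1)] by blast
  then have q\<mu>: "poly q \<mu> \<noteq> 0"
    by (simp add: poly_eq_0_iff_dvd)
  have poly_p: "poly p (- z) = (- 1) ^ order \<mu> p * (z + \<mu>) ^ order \<mu> p * poly q (- z)" for z
  proof -
    have "poly p (- z) = (- (z + \<mu>)) ^ order \<mu> p * poly q (- z)"
      by (subst p) (simp add: poly_power minus_diff_commute)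
    also have "(- (z + \<mu>)) ^ order \<mu> p = (- 1) ^ order \<mu> p * (z + \<mu>) ^ order \<mu> p"
      by (rule power_minus)
    finally show ?thesis .
  qed
  have q: "poly q (- z) \<noteq> 0" if "z \<in> S" for z
    using S(3) [OF that] q\<mu> by (cases "z = - \<mu>") (auto simp: poly_p)
  let ?h = "\<lambda>z. poly N z * (z + \<mu>) ^ (k - order \<mu> p) / ((- 1) ^ order \<mu> p * poly q (- z))"
  have "poly N z * (z + \<mu>) ^ k / poly p (- z) = ?h z" if "z \<noteq> - \<mu>" for z
  proof -
    have "z + \<mu> \<noteq> 0"
      using that by (simp add: eq_neg_iff_add_eq_0)
    moreover have "(z + \<mu>) ^ k = (z + \<mu>) ^ (k - order \<mu> p) * (z + \<mu>) ^ order \<mu> p"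
      using assms(2) by (simp add: power_add [symmetric])
    ultimately show ?thesis
      by (simp add: poly_p)
  qed
  then have "principal_coeff p N \<mu> k = residue ?h (- \<mu>)"
    unfolding principal_coeff_def
    by (intro residue_cong refl) (auto simp: eventually_at_filter)
  also have "\<dots> = 0"
    using q by (intro residue_holo [OF S(1,2)]) (auto intro!: holomorphic_intros)
  finally show ?thesis .
qed

lemma inverse_laplace_add:
  "p \<noteq> 0 \<Longrightarrow> inverse_laplace p (N + N') t = inverse_laplace p N t + inverse_laplace p N' t"
  by (simp add: inverse_laplace_def principal_coeff_add algebra_simps sum.distrib)

lemma inverse_laplace_smult:
  "p \<noteq> 0 \<Longrightarrow> inverse_laplace p (smult c N) t = c * inverse_laplace p N t"
  by (simp add: inverse_laplace_def principal_coeff_smult sum_distrib_left mult.assoc)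

lemma inverse_laplace_sum:
  "p \<noteq> 0 \<Longrightarrow> inverse_laplace p (\<Sum>i\<in>I. N i) t = (\<Sum>i\<in>I. inverse_laplace p (N i) t)"
  using inverse_laplace_smult [of p 0 0 t]
  by (induction I rule: infinite_finite_induct) (simp_all add: inverse_laplace_add)

text \<open>
  The numerator cancels the denominator, and no pole is left.
\<close>

lemma inverse_laplace_eq_0:
  assumes p: "p \<noteq> 0" and N: "\<And>z. poly N z = poly p (- z)"
  shows "inverse_laplace p N t = 0"
proof -
  have "principal_coeff p N \<mu> k = 0" for \<mu> k
  proof -
    obtain S where S: "open S" "- \<mu> \<in> S" "\<And>z. z \<in> S \<Longrightarrow> z \<noteq> - \<mu> \<Longrightarrow> poly p (- z) \<noteq> 0"
      using isolated_root [OF p] by blast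
    have "\<forall>\<^sub>F z in at (- \<mu>). z \<in> S - {- \<mu>}"
      using S(1,2) by (rule eventually_at_in_open)
    then have "\<forall>\<^sub>F z in at (- \<mu>). poly N z * (z + \<mu>) ^ k / poly p (- z) = (z + \<mu>) ^ k"
      by eventually_elim (use S in \<open>auto simp: N\<close>)
    then have "principal_coeff p N \<mu> k = residue (\<lambda>z. (z + \<mu>) ^ k) (- \<mu>)"
      unfolding principal_coeff_def by (rule residue_cong) simp
    also have "\<dots> = 0"
      by (rule residue_holo [of UNIV]) (auto intro!: holomorphic_intros)
    finally show ?thesis .
  qed
  then show ?thesis
    by (simp add: inverse_laplace_def)
qed

text \<open>
  The derivative of \<open>t ^ k / fact k\<close> is the preceding function of this kind. The assumption
  \<open>c n = 0\<close> keeps the sum in the same range after the shift of the index.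
\<close>

lemma exp_polynomial_has_vector_derivative:
  fixes c :: "nat \<Rightarrow> complex"
  assumes "c n = 0"
  shows "((\<lambda>t. \<Sum>k<n. c k * (of_real t ^ k / fact k) * exp (- \<mu> * of_real t)) has_vector_derivative
    (\<Sum>k<n. (- \<mu> * c k + c (Suc k)) * (of_real t ^ k / fact k) * exp (- \<mu> * of_real t))) (at t)"
proof -
  let ?e = "\<lambda>k z. z ^ k / fact k :: complex"
  let ?d = "\<lambda>k z. case k of 0 \<Rightarrow> 0 | Suc j \<Rightarrow> ?e j z"
  have e: "(?e k has_field_derivative ?d k z) (at z)" for k z
  proof (cases k)
    case (Suc j)
    have "(?e (Suc j) has_field_derivative (of_nat (Suc j) * z ^ j) / fact (Suc j)) (at z)"
      by (rule DERIV_cdivide) (auto intro!: derivative_eq_intros simp del: power_Suc)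
    moreover have "(of_nat (Suc j) * z ^ j) / fact (Suc j) = ?e j z"
      by (simp del: of_nat_Suc)
    ultimately show ?thesis
      using Suc by simp
  qed simp
  have shift: "(\<Sum>k<n. c k * ?d k z) = (\<Sum>k<n. c (Suc k) * ?e k z)" for z
  proof -
    have "(\<Sum>k<n. c k * ?d k z) = (\<Sum>k<Suc n. c k * ?d k z)"
      using assms by simp
    also have "\<dots> = (\<Sum>k<n. c (Suc k) * ?e k z)"
      by (subst sum.lessThan_Suc_shift) simp
    finally show ?thesis .
  qed
  have "((\<lambda>z. (\<Sum>k<n. c k * ?e k z) * exp (- \<mu> * z)) has_field_derivative
      (\<Sum>k<n. c k * ?d k z) * exp (- \<mu> * z) + (- \<mu> * exp (- \<mu> * z)) * (\<Sum>k<n. c k * ?e k z)) (at z)" for z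
    by (intro DERIV_mult DERIV_sum DERIV_cmult e) (auto intro!: derivative_eq_intros)
  then have "((\<lambda>t. (\<Sum>k<n. c k * ?e k (of_real t)) * exp (- \<mu> * of_real t)) has_vector_derivative
      (\<Sum>k<n. c (Suc k) * ?e k (of_real t)) * exp (- \<mu> * of_real t) +
      (- \<mu> * exp (- \<mu> * of_real t)) * (\<Sum>k<n. c k * ?e k (of_real t))) (at t)"
    unfolding shift by (rule has_vector_derivative_real_field)
  then show ?thesis
    by (simp add: sum_distrib_right sum_distrib_left sum.distrib [symmetric] algebra_simps)
qed

lemma inverse_laplace_has_vector_derivative:
  assumes "p \<noteq> 0"
  shows "(inverse_laplace p N has_vector_derivative inverse_laplace p ([:0, 1:] * N) t) (at t)"
  unfolding inverse_laplace_def [abs_def] principal_coeff_times_X [OF assms]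
  by (intro has_vector_derivative_sum exp_polynomial_has_vector_derivative principal_coeff_eq_0 assms order_refl)

lemma inverse_laplace_0:
  assumes "p \<noteq> 0" and lim: "((\<lambda>z. z * (poly N z / poly p (- z))) \<longlongrightarrow> c) at_infinity"
  shows "inverse_laplace p N 0 = c"
proof -
  let ?Z = "{z. poly p z = 0}"
  have fin: "finite ?Z"
    using assms(1) by (rule poly_roots_finite)
  have "inverse_laplace p N 0 = (\<Sum>\<mu>\<in>?Z. principal_coeff p N \<mu> 0)"
    unfolding inverse_laplace_def
  proof (rule sum.cong [OF refl])
    fix \<mu> assume "\<mu> \<in> ?Z"
    then have "0 < order \<mu> p"
      using assms(1) by (simp add: order_gt_0_iff)
    have "(\<Sum>k<order \<mu> p. principal_coeff p N \<mu> k * (of_real 0 ^ k / fact k) * exp (- \<mu> * of_real 0)) =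
        (\<Sum>k<order \<mu> p. if k = 0 then principal_coeff p N \<mu> 0 else 0)"
      by (intro sum.cong) auto
    also have "\<dots> = principal_coeff p N \<mu> 0"
      using \<open>0 < order \<mu> p\<close> by simp
    finally show "(\<Sum>k<order \<mu> p. principal_coeff p N \<mu> k * (of_real 0 ^ k / fact k) * exp (- \<mu> * of_real 0)) =
        principal_coeff p N \<mu> 0" .
  qed
  also have "\<dots> = (\<Sum>s\<in>uminus ` ?Z. residue (\<lambda>z. poly N z / poly p (- z)) s)"
    by (subst sum.reindex) (auto simp: principal_coeff_def)
  also have "\<dots> = c"
  proof (rule sum_residues_eq_limit_at_infinity [OF _ _ lim])
    have "poly p (- z) \<noteq> 0" if "z \<notin> uminus ` ?Z" for z
      using that image_eqI [of z uminus "- z" ?Z] by auto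
    then show "(\<lambda>z. poly N z / poly p (- z)) holomorphic_on - uminus ` ?Z"
      by (auto intro!: holomorphic_intros)
  qed (use fin in simp)
  finally show ?thesis .
qed

text \<open>
  For \<open>t \<ge> 0\<close> each exponential is dominated by the one with the smallest decay rate.
\<close>

lemma norm_inverse_laplace_le:
  assumes p: "p \<noteq> 0" and r: "\<And>\<mu>. poly p \<mu> = 0 \<Longrightarrow> r \<le> Re \<mu>" and "0 \<le> t"
  shows "norm (inverse_laplace p N t) \<le>
    (\<Sum>\<mu>\<in>{z. poly p z = 0}. \<Sum>k<order \<mu> p. norm (principal_coeff p N \<mu> k) * (t ^ k / fact k * exp (- r * t)))"
  unfolding inverse_laplace_def
proof (intro sum_norm_le)
  fix \<mu> k assume "\<mu> \<in> {z. poly p z = 0}"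
  then have "exp (- Re \<mu> * t) \<le> exp (- r * t)"
    using r \<open>0 \<le> t\<close> by (auto intro: mult_right_mono)
  then show "norm (principal_coeff p N \<mu> k * (of_real t ^ k / fact k) * exp (- \<mu> * of_real t)) \<le>
      norm (principal_coeff p N \<mu> k) * (t ^ k / fact k * exp (- r * t))"
    using \<open>0 \<le> t\<close>
    by (simp add: norm_mult norm_divide norm_power norm_exp_eq_Re mult.assoc mult_left_mono divide_right_mono)
qed

text \<open>
  A slightly smaller rate \<open>b\<close> absorbs the powers of \<open>t\<close>. The range starts at \<open>- 1\<close> to meet the
  hypotheses of \<open>generator_weighted_mean\<close>; \<open>t + 2\<close> replaces \<open>t\<close> in the powers since it is positive and
  dominates \<open>\<bar>t\<bar>\<close> there.
\<close>

lemma inverse_laplace_bound: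
  assumes p: "p \<noteq> 0" and r: "\<And>\<mu>. poly p \<mu> = 0 \<Longrightarrow> r \<le> Re \<mu>" and "b < r"
  shows "\<exists>K. \<forall>t\<ge>- 1. norm (inverse_laplace p N t) \<le> K * exp (- b * t)"
proof -
  define d where "d = r - b"
  have d: "0 < d"
    using \<open>b < r\<close> by (simp add: d_def)
  define L where "L \<mu> k = norm (principal_coeff p N \<mu> k) * (exp (2 * d) / d ^ k) * exp (Re \<mu> - r)" for \<mu> k
  have "norm (inverse_laplace p N t) \<le> (\<Sum>\<mu>\<in>{z. poly p z = 0}. \<Sum>k<order \<mu> p. L \<mu> k) * exp (- b * t)" if t: "- 1 \<le> t" for t
    unfolding inverse_laplace_def sum_distrib_right
  proof (intro sum_norm_le)
    fix \<mu> k assume "\<mu> \<in> {z. poly p z = 0}"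
    then have re: "0 \<le> Re \<mu> - r"
      using r by simp
    have "\<bar>t\<bar> ^ k / fact k \<le> (t + 2) ^ k / fact k"
      using t by (intro divide_right_mono power_mono) auto
    also have "\<dots> \<le> exp (d * (t + 2)) / d ^ k"
      using d t by (intro power_over_fact_le_exp) auto
    finally have 1: "\<bar>t\<bar> ^ k / fact k \<le> exp (d * (t + 2)) / d ^ k" .
    have "- Re \<mu> * t \<le> - r * t + (Re \<mu> - r)"
      using mult_left_mono [OF t re] by (simp add: algebra_simps)
    then have 2: "exp (- Re \<mu> * t) \<le> exp (- r * t + (Re \<mu> - r))"
      by simp
    have "norm (principal_coeff p N \<mu> k * (of_real t ^ k / fact k) * exp (- \<mu> * of_real t)) =
        norm (principal_coeff p N \<mu> k) * (\<bar>t\<bar> ^ k / fact k * exp (- Re \<mu> * t))"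
      by (simp add: norm_mult norm_divide norm_power norm_exp_eq_Re mult.assoc)
    also have "\<dots> \<le> norm (principal_coeff p N \<mu> k) * (exp (d * (t + 2)) / d ^ k * exp (- r * t + (Re \<mu> - r)))"
      using 1 2 d by (intro mult_left_mono mult_mono) auto
    also have "\<dots> = L \<mu> k * exp (- b * t)"
    proof -
      have "exp (d * (t + 2)) * exp (- r * t + (Re \<mu> - r)) = exp (2 * d) * exp (Re \<mu> - r) * exp (- b * t)"
        by (simp add: exp_add [symmetric] d_def algebra_simps)
      then show ?thesis
        by (simp add: L_def field_simps)
    qed
    finally show "norm (principal_coeff p N \<mu> k * (of_real t ^ k / fact k) * exp (- \<mu> * of_real t)) \<le>
        L \<mu> k * exp (- b * t)" .
  qed
  then show ?thesis
    by blast
qed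

section \<open>The initial value problem\<close>

text \<open>
  The behaviour at infinity that yields the initial values: all vanish up to order \<open>n - 1\<close>, and the next one is
  the reciprocal of the leading coefficient of \<open>p(- z)\<close>.
\<close>

lemma mult_power_div_poly_tendsto:
  fixes p :: "complex poly"
  assumes deg: "degree p = Suc n" and "j \<le> n"
  shows "((\<lambda>z. z * (z ^ j / poly p (- z))) \<longlongrightarrow>
    (if j = n then 1 / ((- 1) ^ Suc n * lead_coeff p) else 0)) at_infinity"
proof -
  define q where "q = pcompose p [:0, - 1:]"
  have q: "poly p (- z) = poly q z" for z
    by (simp add: q_def poly_pcompose)
  have degq: "degree q = Suc n"
    by (simp add: q_def degree_pcompose deg)
  have leadq: "lead_coeff q = (- 1) ^ Suc n * lead_coeff p"
    by (simp add: q_def lead_coeff_comp deg)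
  have "q \<noteq> 0"
    using degq by auto
  show ?thesis
  proof (cases "j = n")
    case True
    have "((\<lambda>z. inverse (poly q z / z ^ degree q)) \<longlongrightarrow> inverse (lead_coeff q)) at_infinity"
      using \<open>q \<noteq> 0\<close> by (intro tendsto_inverse poly_divide_tendsto_aux) simp
    then show ?thesis
      unfolding q leadq [symmetric] using True by (simp add: degq inverse_eq_divide)
  next
    case False
    have "((\<lambda>z. poly (monom 1 (Suc j)) z / poly q z) \<longlongrightarrow> 0) at_infinity"
      using False assms(2) by (intro poly_divide_tendsto_0_at_infinity) (simp add: degree_monom_eq degq)
    then show ?thesis
      using False by (simp add: poly_monom q)
  qed
qed

text \<open>
  The \<open>j\<close>-th derivative of the function with Laplace transform \<open>1 / P (- z)\<close>. Taking the real part is compatible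
  with the differential equation and the initial values because \<open>P\<close> has real coefficients.
\<close>

definition laplace_kernel :: "real poly \<Rightarrow> nat \<Rightarrow> real \<Rightarrow> real" where
  "laplace_kernel P j t = Re (inverse_laplace (complex_poly P) (monom 1 j) t)"

lemma complex_poly_eq_0_iff: "complex_poly P = 0 \<longleftrightarrow> P = 0"
  by (simp add: poly_eq_iff coeff_map_poly)

lemma laplace_kernel_has_derivative:
  assumes "P \<noteq> 0"
  shows "(laplace_kernel P j has_real_derivative laplace_kernel P (Suc j) t) (at t)"
proof -
  have "[:0, 1:] * monom 1 j = (monom 1 (Suc j) :: complex poly)"
    by (simp add: monom_Suc)
  then have "(inverse_laplace (complex_poly P) (monom 1 j) has_vector_derivative
      inverse_laplace (complex_poly P) (monom 1 (Suc j)) t) (at t)"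
    using inverse_laplace_has_vector_derivative [of "complex_poly P" "monom 1 j" t] assms
    by (simp add: complex_poly_eq_0_iff)
  from bounded_linear.has_vector_derivative [OF bounded_linear_Re this] show ?thesis
    by (simp add: laplace_kernel_def [abs_def] has_real_derivative_iff_has_vector_derivative)
qed

lemma laplace_kernel_ode:
  assumes "P \<noteq> 0"
  shows "(\<Sum>k\<le>degree P. (- 1) ^ k * coeff P k * laplace_kernel P k t) = 0"
proof -
  let ?p = "complex_poly P"
  let ?N = "\<Sum>k\<le>degree P. smult (of_real ((- 1) ^ k * coeff P k)) (monom 1 k)"
  have p: "?p \<noteq> 0"
    using assms by (simp add: complex_poly_eq_0_iff)
  have "poly ?N z = poly ?p (- z)" for z
  proof -
    have "poly ?N z = (\<Sum>k\<le>degree P. of_real (coeff P k) * (- z) ^ k)"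
      by (simp add: poly_sum poly_monom power_minus [of z] mult_ac)
    also have "\<dots> = poly ?p (- z)"
      by (simp add: poly_altdef degree_map_poly coeff_map_poly)
    finally show ?thesis .
  qed
  then have "inverse_laplace ?p ?N t = 0"
    by (rule inverse_laplace_eq_0 [OF p])
  then have "(\<Sum>k\<le>degree P. of_real ((- 1) ^ k * coeff P k) * inverse_laplace ?p (monom 1 k) t) = 0"
    by (simp only: inverse_laplace_sum [OF p] inverse_laplace_smult [OF p])
  then have "Re (\<Sum>k\<le>degree P. of_real ((- 1) ^ k * coeff P k) * inverse_laplace ?p (monom 1 k) t) = 0"
    by simp
  then show ?thesis
    by (simp only: Re_sum Re_complex_of_real times_complex.sel Im_complex_of_real mult_zero_left diff_zero laplace_kernel_def)
qed

lemma laplace_kernel_0: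
  assumes deg: "degree P = Suc n" and "j \<le> n"
  shows "laplace_kernel P j 0 = (if j = n then 1 / ((- 1) ^ Suc n * lead_coeff P) else 0)"
proof -
  let ?p = "complex_poly P"
  have "degree ?p = Suc n" "?p \<noteq> 0"
    using deg by (auto simp: degree_map_poly complex_poly_eq_0_iff)
  then have "inverse_laplace ?p (monom 1 j) 0 = (if j = n then 1 / ((- 1) ^ Suc n * lead_coeff ?p) else 0)"
    using mult_power_div_poly_tendsto [of ?p n j] assms(2) by (intro inverse_laplace_0) (simp_all add: poly_monom)
  also have "\<dots> = of_real (if j = n then 1 / ((- 1) ^ Suc n * lead_coeff P) else 0)"
    by (simp add: degree_map_poly coeff_map_poly)
  finally show ?thesis
    by (simp only: laplace_kernel_def Re_complex_of_real)
qed

text \<open>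
  Energy method. Let \<open>E\<close> be the sum of the squares of the functions \<open>f k\<close> with \<open>k < n\<close>. The equation bounds the
  \<open>n\<close>-th derivative, and thus every derivative up to order \<open>n\<close>, by a multiple of \<open>sqrt (E t)\<close>. So
  \<open>E' \<le> L * E\<close> for a constant \<open>L\<close>, the nonnegative function \<open>exp (- L * t) * E t\<close> does not increase, and it starts at \<open>0\<close>.
\<close>

lemma linear_ode_zero_solution:
  fixes f :: "nat \<Rightarrow> real \<Rightarrow> real"
  assumes der: "\<And>k t. 0 \<le> t \<Longrightarrow> (f k has_vector_derivative f (Suc k) t) (at t within {0..})"
    and ode: "\<And>t. 0 \<le> t \<Longrightarrow> (\<Sum>k\<le>n. c k * f k t) = 0" and "c n \<noteq> 0"
    and init: "\<And>k. k < n \<Longrightarrow> f k 0 = 0"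
    and k: "k < n" and t: "0 \<le> t"
  shows "f k t = 0"
proof -
  define E where "E t = (\<Sum>k<n. (f k t)\<^sup>2)" for t
  define C where "C = (\<Sum>k<n. \<bar>c k / c n\<bar>)"
  define L where "L = 2 * real n * (1 + C)"
  have C: "0 \<le> C"
    by (simp add: C_def sum_nonneg)
  have low: "\<bar>f k s\<bar> \<le> sqrt (E s)" if "k < n" for k s
  proof -
    have "(f k s)\<^sup>2 \<le> E s"
      unfolding E_def using that by (intro member_le_sum) auto
    then show ?thesis
      by (metis real_sqrt_abs real_sqrt_le_mono)
  qed
  have top: "\<bar>f n s\<bar> \<le> C * sqrt (E s)" if "0 \<le> s" for s
  proof -
    have "(\<Sum>k<n. c k * f k s) + c n * f n s = 0"
      using ode [OF that] by (simp add: lessThan_Suc_atMost [symmetric])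
    then have "f n s = - (\<Sum>k<n. c k * f k s) / c n"
      using \<open>c n \<noteq> 0\<close> by (simp add: field_simps)
    then have "\<bar>f n s\<bar> = \<bar>\<Sum>k<n. c k / c n * f k s\<bar>"
      by (simp add: sum_divide_distrib)
    also have "\<dots> \<le> (\<Sum>k<n. \<bar>c k / c n\<bar> * \<bar>f k s\<bar>)"
      using sum_abs [of "\<lambda>k. c k / c n * f k s"] by (simp add: abs_mult)
    also have "\<dots> \<le> (\<Sum>k<n. \<bar>c k / c n\<bar> * sqrt (E s))"
      using low by (intro sum_mono mult_left_mono) auto
    finally show ?thesis
      by (simp add: C_def sum_distrib_right)
  qed
  have next_le: "\<bar>f (Suc k) s\<bar> \<le> (1 + C) * sqrt (E s)" if "k < n" "0 \<le> s" for k s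
  proof (cases "Suc k = n")
    case True
    with top [OF that(2)] show ?thesis
      using that(2) by (auto simp: algebra_simps E_def sum_nonneg intro: add_increasing)
  next
    case False
    then have "\<bar>f (Suc k) s\<bar> \<le> sqrt (E s)"
      using that by (intro low) simp
    also have "\<dots> \<le> (1 + C) * sqrt (E s)"
      using C by (simp add: algebra_simps E_def sum_nonneg)
    finally show ?thesis .
  qed
  let ?E' = "\<lambda>s. \<Sum>k<n. 2 * f k s * f (Suc k) s"
  have E': "?E' s \<le> L * E s" if "0 \<le> s" for s
  proof -
    have "?E' s \<le> (\<Sum>k<n. 2 * (sqrt (E s) * ((1 + C) * sqrt (E s))))"
    proof (rule sum_mono)
      fix k assume "k \<in> {..<n}"
      then have "\<bar>f k s\<bar> * \<bar>f (Suc k) s\<bar> \<le> sqrt (E s) * ((1 + C) * sqrt (E s))"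
        using low next_le that by (intro mult_mono) (auto simp: E_def sum_nonneg)
      moreover have "f k s * f (Suc k) s \<le> \<bar>f k s\<bar> * \<bar>f (Suc k) s\<bar>"
        by (metis abs_ge_self abs_mult)
      ultimately show "2 * f k s * f (Suc k) s \<le> 2 * (sqrt (E s) * ((1 + C) * sqrt (E s)))"
        by simp
    qed
    also have "\<dots> = L * (sqrt (E s) * sqrt (E s))"
      by (simp add: L_def algebra_simps)
    also have "sqrt (E s) * sqrt (E s) = E s"
      by (simp add: E_def sum_nonneg)
    finally show ?thesis .
  qed
  let ?G = "\<lambda>s. exp (- L * s) * E s"
  let ?G' = "\<lambda>s. exp (- L * s) * (?E' s - L * E s)"
  have "(?G has_derivative (\<lambda>h. h * ?G' s)) (at s within {0..t})" if "s \<in> {0..t}" for s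
  proof -
    have f: "(f k has_real_derivative f (Suc k) s) (at s within {0..t})" for k
      using der [of s k] that
      by (auto simp: has_real_derivative_iff_has_vector_derivative intro: has_vector_derivative_within_subset)
    have "(E has_real_derivative ?E' s) (at s within {0..t})"
      unfolding E_def [abs_def] by (auto intro!: derivative_eq_intros f sum.cong)
    then have "(?G has_real_derivative ?G' s) (at s within {0..t})"
      by (auto intro!: derivative_eq_intros simp: algebra_simps)
    then show ?thesis
      by (simp add: has_field_derivative_def mult.commute [of _ "?G' s"] mult_commute_abs)
  qed
  with t obtain s where s: "s \<in> {0..t}" "?G t - ?G 0 = (t - 0) * ?G' s"
    using mvt_very_simple [of 0 t ?G "\<lambda>s h. h * ?G' s"] by auto
  moreover have "?G' s \<le> 0"
    using E' [of s] s(1) by (simp add: mult_nonneg_nonpos)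
  moreover have "E 0 = 0"
    using init by (simp add: E_def)
  ultimately have "?G t \<le> 0"
    using t by (simp add: mult_nonneg_nonpos)
  then have "E t \<le> 0"
    by (simp add: mult_le_0_iff)
  then have "E t = 0"
    by (simp add: E_def sum_nonneg antisym)
  with low [OF k, of t] show ?thesis
    by simp
qed

lemma half_line_deriv_eqI:
  assumes "(f has_vector_derivative D) (at t within {0..})" "0 \<le> t"
  shows "half_line_deriv f t = D"
proof -
  have "at_right t \<le> at t within {0..}"
    using assms(2) by (intro at_le) auto
  then have "at t within {0..} \<noteq> bot"
    using trivial_limit_at_right_real [of t] by (metis bot.extremum_uniqueI)
  then show ?thesis
    unfolding half_line_deriv_def using assms(1) by (rule vector_derivative_within)
qed

lemma half_line_deriv_iterate:
  assumes der: "\<And>k t. 0 \<le> t \<Longrightarrow> (g k has_vector_derivative g (Suc k) t) (at t within {0..})"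
    and eq: "\<And>t. 0 \<le> t \<Longrightarrow> f t = g 0 t" and "0 \<le> t"
  shows "(half_line_deriv ^^ k) f t = g k t"
  using \<open>0 \<le> t\<close>
proof (induction k arbitrary: t)
  case (Suc k)
  have "((half_line_deriv ^^ k) f has_vector_derivative g (Suc k) t) (at t within {0..})"
    using Suc by (intro has_vector_derivative_transform [OF _ _ der]) auto
  then show ?case
    using Suc.prems by (simp add: half_line_deriv_eqI)
qed (simp add: eq)

lemma differentiable_half_line_deriv:
  assumes "f differentiable_on {0..}" "0 \<le> t"
  shows "(f has_vector_derivative half_line_deriv f t) (at t within {0..})"
  using assms by (simp add: differentiable_on_def half_line_deriv_def vector_derivative_works)

text \<open>
  Existence is the hypothesis on \<open>g\<close>; the difference of two solutions has zero initial values, so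
  \<open>linear_ode_zero_solution\<close> gives uniqueness.
\<close>

lemma ivp_solution_eqI:
  fixes g :: "nat \<Rightarrow> real \<Rightarrow> real"
  assumes der: "\<And>k t. 0 \<le> t \<Longrightarrow> (g k has_vector_derivative g (Suc k) t) (at t within {0..})"
    and deg: "degree P = m + 2"
    and ode: "\<And>t. 0 \<le> t \<Longrightarrow> (\<Sum>k\<le>m + 2. (- 1) ^ k * coeff P k * g k t) = 0"
    and init: "\<And>k. k \<le> m \<Longrightarrow> g k 0 = 0"
    and init': "g (m + 1) 0 = (- 1) ^ m * inverse (coeff P (m + 2))"
  shows "ivp_solution m P = (\<lambda>t. if t < 0 then 0 else g 0 t)"
  unfolding ivp_solution_def
proof (rule the_equality)
  let ?g = "\<lambda>t. if t < 0 then 0 else g 0 t"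
  have iter: "(half_line_deriv ^^ k) ?g t = g k t" if "0 \<le> t" for k t
    using der that by (intro half_line_deriv_iterate) auto
  have "(half_line_deriv ^^ k) ?g differentiable_on {0..}" for k
    unfolding differentiable_on_def
  proof
    fix t :: real assume "t \<in> {0..}"
    then have "((half_line_deriv ^^ k) ?g has_vector_derivative g (Suc k) t) (at t within {0..})"
      using iter by (intro has_vector_derivative_transform [OF _ _ der]) auto
    then show "(half_line_deriv ^^ k) ?g differentiable at t within {0..}"
      by (rule differentiableI_vector)
  qed
  then show "solves_ivp m P ?g \<and> (\<forall>t<0. ?g t = 0)"
    using iter ode init init' by (simp add: solves_ivp_def atLeast0AtMost del: funpow.simps)
next
  fix f assume "solves_ivp m P f \<and> (\<forall>t<0. f t = 0)"
  then have f: "(half_line_deriv ^^ k) f differentiable_on {0..}"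
    and fode: "0 \<le> t \<Longrightarrow> (\<Sum>k\<le>m + 2. (- 1) ^ k * coeff P k * (half_line_deriv ^^ k) f t) = 0"
    and finit: "k \<le> m \<Longrightarrow> (half_line_deriv ^^ k) f 0 = 0"
    and finit': "(half_line_deriv ^^ (m + 1)) f 0 = (- 1) ^ m * inverse (coeff P (m + 2))"
    and neg: "t < 0 \<Longrightarrow> f t = 0" for k t
    unfolding solves_ivp_def atLeast0AtMost by blast+
  let ?d = "\<lambda>k t. (half_line_deriv ^^ k) f t - g k t"
  have "?d 0 t = 0" if t: "0 \<le> t" for t
  proof (rule linear_ode_zero_solution [where f = ?d and n = "m + 2" and c = "\<lambda>k. (- 1) ^ k * coeff P k"])
    fix k and s :: real assume s: "0 \<le> s"
    show "(?d k has_vector_derivative ?d (Suc k) s) (at s within {0..})"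
      using differentiable_half_line_deriv [OF f s, of k] der [OF s, of k]
      by (auto intro: has_vector_derivative_diff)
    show "(\<Sum>k\<le>m + 2. (- 1) ^ k * coeff P k * ?d k s) = 0"
      using fode [OF s] ode [OF s] by (simp only: right_diff_distrib sum_subtractf)
  next
    show "?d k 0 = 0" if "k < m + 2" for k
      using that finit [of k] finit' init [of k] init' by (cases "k = m + 1") auto
  qed (use t deg leading_coeff_0_iff [of P] in auto)
  then show "f = (\<lambda>t. if t < 0 then 0 else g 0 t)"
    using neg by auto
qed

lemma laplace_kernel_le:
  assumes P: "P \<noteq> 0" and "0 \<le> t"
  shows "\<bar>laplace_kernel P 0 t\<bar> \<le> (\<Sum>(\<mu>, k)\<in>Sigma (roots P) (\<lambda>\<mu>. {..<order \<mu> (complex_poly P)}).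
    cmod (laurent_coeff P \<mu> (Suc k)) * (t ^ k / fact k * exp (- min_re_root P * t)))"
proof -
  let ?p = "complex_poly P"
  have p: "?p \<noteq> 0"
    using P by (simp add: complex_poly_eq_0_iff)
  have fin: "finite (roots P)"
    unfolding roots_def using p by (rule poly_roots_finite)
  have "\<bar>laplace_kernel P 0 t\<bar> \<le> cmod (inverse_laplace ?p (monom 1 0) t)"
    unfolding laplace_kernel_def by (rule abs_Re_le_cmod)
  also have "\<dots> \<le> (\<Sum>\<mu>\<in>roots P. \<Sum>k<order \<mu> ?p. cmod (principal_coeff ?p (monom 1 0) \<mu> k) *
      (t ^ k / fact k * exp (- min_re_root P * t)))"
    unfolding roots_def using p
  proof (rule norm_inverse_laplace_le)
    fix \<mu> assume "poly ?p \<mu> = 0"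
    then show "min_re_root P \<le> Re \<mu>"
      using fin unfolding min_re_root_def by (intro Min_le) (auto simp: roots_def)
  qed (rule \<open>0 \<le> t\<close>)
  also have "\<dots> = (\<Sum>\<mu>\<in>roots P. \<Sum>k<order \<mu> ?p. cmod (laurent_coeff P \<mu> (Suc k)) *
      (t ^ k / fact k * exp (- min_re_root P * t)))"
    by (simp add: principal_coeff_def laurent_coeff_def poly_monom)
  also have "\<dots> = (\<Sum>(\<mu>, k)\<in>Sigma (roots P) (\<lambda>\<mu>. {..<order \<mu> ?p}).
    cmod (laurent_coeff P \<mu> (Suc k)) * (t ^ k / fact k * exp (- min_re_root P * t)))"
    using fin by (intro sum.Sigma) auto
  finally show ?thesis .
qed

lemma laplace_kernel_bound:
  assumes "P \<noteq> 0" "b < min_re_root P"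
  shows "\<exists>K. \<forall>t\<ge>- 1. \<bar>laplace_kernel P j t\<bar> \<le> K * exp (- b * t)"
proof -
  let ?p = "complex_poly P"
  have p: "?p \<noteq> 0"
    using assms by (simp add: complex_poly_eq_0_iff)
  have "finite (roots P)"
    unfolding roots_def using p by (rule poly_roots_finite)
  then have "min_re_root P \<le> Re \<mu>" if "poly ?p \<mu> = 0" for \<mu>
    using that unfolding min_re_root_def by (intro Min_le) (auto simp: roots_def)
  then obtain K where "\<forall>t\<ge>- 1. cmod (inverse_laplace ?p (monom 1 j) t) \<le> K * exp (- b * t)"
    using inverse_laplace_bound [OF p _ assms(2)] by blast
  then show ?thesis
    unfolding laplace_kernel_def by (meson abs_Re_le_cmod order_trans)
qed

lemma ivp_solution_eq_laplace_kernel: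
  assumes deg: "degree P = m + 2" and "0 \<le> t"
  shows "(half_line_deriv ^^ k) (ivp_solution m P) t = laplace_kernel P k t"
proof -
  have P: "P \<noteq> 0"
    using deg by auto
  have der: "(laplace_kernel P k has_vector_derivative laplace_kernel P (Suc k) t) (at t within {0..})" for k t
    using laplace_kernel_has_derivative [OF P]
    by (auto simp: has_real_derivative_iff_has_vector_derivative intro: has_vector_derivative_at_within)
  have "ivp_solution m P = (\<lambda>t. if t < 0 then 0 else laplace_kernel P 0 t)"
  proof (rule ivp_solution_eqI [where g = "laplace_kernel P", OF der deg])
    show "(\<Sum>k\<le>m + 2. (- 1) ^ k * coeff P k * laplace_kernel P k t) = 0" for t
      using laplace_kernel_ode [OF P] deg by metis
    show "laplace_kernel P k 0 = 0" if "k \<le> m" for k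
      using laplace_kernel_0 [of P "m + 1" k] deg that by simp
    show "laplace_kernel P (m + 1) 0 = (- 1) ^ m * inverse (coeff P (m + 2))"
    proof -
      have "laplace_kernel P (m + 1) 0 = 1 / ((- 1) ^ m * coeff P (m + 2))"
        using laplace_kernel_0 [of P "m + 1" "m + 1"] deg by simp
      then show ?thesis
        by (cases "even m") (simp_all add: inverse_eq_divide)
    qed
  qed
  then show ?thesis
    using \<open>0 \<le> t\<close> by (intro half_line_deriv_iterate [where g = "laplace_kernel P", OF der]) auto
qed

section \<open>Two-sided modules\<close>

context banach_two_sided_module
begin

lemma rm_scaleR: "rm (r *\<^sub>R x) q = r *\<^sub>R rm x q"
proof -
  have "rm (r *\<^sub>R x) q = rm x (of_real r * q)"
    by (simp only: rm_of_real [symmetric] rm_assoc)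
  also have "of_real r * q = q * of_real r"
    by (simp add: of_real_def)
  also have "rm x (q * of_real r) = r *\<^sub>R rm x q"
    by (simp only: rm_of_real [symmetric] rm_assoc)
  finally show ?thesis .
qed

lemma bounded_linear_rm: "bounded_linear (\<lambda>x. rm x q)"
  using norm_rm by (intro bounded_linear_intro [where K = "clifford_norm q"])
    (auto simp: rm_add_left rm_scaleR mult.commute)

text \<open>
  Real multiples are right multiples by real Clifford numbers, so a right linear operator is linear over
  the reals.
\<close>

lemma bounded_right_linear_iff:
  "bounded_right_linear rm B \<longleftrightarrow> bounded_linear B \<and> (\<forall>x q. B (rm x q) = rm (B x) q)"
proof
  assume B: "bounded_right_linear rm B"
  then have add: "B (x + y) = B x + B y" and B_rm: "B (rm x q) = rm (B x) q" for x y q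
    by (auto simp: bounded_right_linear_def right_linear_on_def)
  from B obtain K where K: "x \<noteq> 0 \<Longrightarrow> norm (B x) / norm x \<le> K" for x
    unfolding bounded_right_linear_def bdd_above_def by auto
  have "bounded_linear B"
  proof (rule bounded_linear_intro)
    show "B (r *\<^sub>R x) = r *\<^sub>R B x" for r x
      using B_rm [of x "of_real r"] by (simp only: rm_of_real)
    show "norm (B x) \<le> norm x * K" for x
    proof (cases "x = 0")
      case True
      then show ?thesis
        using add [of 0 0] by simp
    next
      case False
      then show ?thesis
        using K [of x] by (simp add: field_simps)
    qed
  qed (rule add)
  with B_rm show "bounded_linear B \<and> (\<forall>x q. B (rm x q) = rm (B x) q)"
    by blast
next
  assume B: "bounded_linear B \<and> (\<forall>x q. B (rm x q) = rm (B x) q)"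
  then have "norm (B x) / norm x \<le> onorm B" for x
    using onorm [of B x] by (cases "x = 0") (auto simp: divide_le_eq onorm_pos_le)
  then have "bdd_above ((\<lambda>x. norm (B x) / norm x) ` (UNIV - {0}))"
    by (intro bdd_aboveI2)
  with B show "bounded_right_linear rm B"
    by (auto simp: bounded_right_linear_def right_linear_on_def right_submodule_def
        linear_add [OF bounded_linear.linear])
qed

lemma exp_bounded_semigroupI:
  assumes T: "right_linear_semigroup rm T"
    and bdd: "bdd_above ((\<lambda>t. onorm (T t) * exp (- \<omega> * t)) ` {0..})"
    and M: "M = (SUP t\<in>{0..}. onorm (T t) * exp (- \<omega> * t))"
  shows "exp_bounded_semigroup T M \<omega>"
proof (rule exp_bounded_semigroup.intro)
  show T_lin: "bounded_linear (T t)" if "0 \<le> t" for t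
    using T that by (auto simp: right_linear_semigroup_def bounded_right_linear_iff)
  show T0: "T 0 x = x" for x
    using T by (simp add: right_linear_semigroup_def)
  show "T (s + t) x = T s (T t x)" if "0 \<le> s" "0 \<le> t" for s t x
    using T that T0 by (cases "s = 0"; cases "t = 0") (auto simp: right_linear_semigroup_def)
  show "continuous_on {0..} (\<lambda>t. T t x)" for x
    using T by (simp add: right_linear_semigroup_def)
  show "norm (T t x) \<le> M * exp (\<omega> * t) * norm x" if "0 \<le> t" for t x
  proof -
    have "onorm (T t) * exp (- \<omega> * t) \<le> M"
      unfolding M using that by (intro cSUP_upper bdd) auto
    then have "onorm (T t) * exp (- \<omega> * t) * exp (\<omega> * t) \<le> M * exp (\<omega> * t)"
      by (rule mult_right_mono) simp
    then have "onorm (T t) \<le> M * exp (\<omega> * t)"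
      by (simp add: mult.assoc exp_add [symmetric])
    then have "onorm (T t) * norm x \<le> M * exp (\<omega> * t) * norm x"
      by (rule mult_right_mono) simp
    with onorm [OF T_lin [OF that], of x] show ?thesis
      by (rule order_trans)
  qed
qed

end

section \<open>The inverse of a polynomial of the generator\<close>

text \<open>
  The kernel of \<open>P\<close> satisfies the requirements of \<open>semigroup_kernel\<close> with \<open>n = m + 1\<close>, and the inverse is the
  weighted mean. The two integral formulas are instances of one combination of its derivatives, and right
  linearity holds because right multiplication by a Clifford number is bounded and commutes with the semigroup.
\<close>

theorem theorem1p1:
  fixes lm :: "'n::{finite,linorder} clifford \<Rightarrow> 'x::banach \<Rightarrow> 'x"
    and rm :: "'x \<Rightarrow> 'n clifford \<Rightarrow> 'x"
    and m :: nat
    and P :: "real poly"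
    and T :: "real \<Rightarrow> 'x \<Rightarrow> 'x"
    and \<omega> M :: real
  assumes "banach_two_sided_module lm rm"
    and "degree P = m + 2"
    and "right_linear_semigroup rm T"
    and "bdd_above ((\<lambda>t. onorm (T t) * exp (- \<omega> * t)) ` {0..})"
    and "M = (SUP t\<in>{0..}. onorm (T t) * exp (- \<omega> * t))"
    and "min_re_root P > \<omega>"
  shows "let g = ivp_solution m P;
             A = generator T;
             D = power_domain (generator_domain T) A (m + 2);
             R = the_inv_into D (poly_operator P A)
         in bij_betw (poly_operator P A) D UNIV \<and>
            bounded_right_linear rm R \<and>
            (\<forall>x. has_strong_bochner_integral (lebesgue_on {0..}) (\<lambda>t. T t (g t *\<^sub>R x)) (R x)) \<and>
            onorm R \<le> M * (\<Sum>\<mu>\<in>roots P. \<Sum>k=1..order \<mu> (complex_poly P).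
                              cmod (laurent_coeff P \<mu> k) / (min_re_root P - \<omega>) ^ k) \<and>
            (\<forall>p :: nat \<Rightarrow> 'n clifford. \<forall>x.
               has_strong_bochner_integral (lebesgue_on {0..})
                 (\<lambda>t. T t (\<Sum>j=0..m+1. ((half_line_deriv ^^ j) g t * (- 1) ^ j) *\<^sub>R lm (p j) x))
                 (\<Sum>j=0..m+1. (A ^^ j) (R (lm (p j) x))))"
proof -
  interpret banach_two_sided_module lm rm
    by fact
  have P: "P \<noteq> 0"
    using assms(2) by auto
  have lead: "coeff P (m + 2) \<noteq> 0"
    using P assms(2) by (metis leading_coeff_0_iff)
  \<comment> \<open>A rate strictly between the growth of the semigroup and the decay of the kernel.\<close>
  define b where "b = (min_re_root P + \<omega>) / 2"
  have b: "\<omega> < b" "b < min_re_root P"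
    using assms(6) by (auto simp: b_def)
  interpret exp_bounded_semigroup T M \<omega>
    using assms(3-5) by (rule exp_bounded_semigroupI)
  interpret semigroup_kernel T M \<omega> "laplace_kernel P" "m + 1" P b
  proof (intro semigroup_kernel.intro semigroup_kernel_axioms.intro)
    show "exp_bounded_semigroup T M \<omega>"
      by (rule exp_bounded_semigroup_axioms)
    show "(laplace_kernel P j has_real_derivative laplace_kernel P (Suc j) t) (at t)" for j t
      by (rule laplace_kernel_has_derivative [OF P])
    show "\<exists>K. \<forall>t\<ge>- 1. \<bar>laplace_kernel P j t\<bar> \<le> K * exp (- b * t)" for j
      by (rule laplace_kernel_bound [OF P b(2)])
    show "laplace_kernel P j 0 = 0" if "j < m + 1" for j
      using laplace_kernel_0 [of P "m + 1" j] assms(2) that by simp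
    show "(- 1) ^ Suc (m + 1) * lead_coeff P * laplace_kernel P (m + 1) 0 = 1"
      using laplace_kernel_0 [of P "m + 1" "m + 1"] lead assms(2) by simp
    show "(\<Sum>k\<le>Suc (m + 1). (- 1) ^ k * coeff P k * laplace_kernel P k t) = 0" for t
      using laplace_kernel_ode [OF P, of t] assms(2) by simp
  qed (use b assms(2) in auto)
  let ?g = "ivp_solution m P" and ?R = "weighted_mean (laplace_kernel P 0)"
  let ?D = "power_domain (generator_domain T) (generator T) (m + 2)"
  have g: "(half_line_deriv ^^ k) ?g t = laplace_kernel P k t" if "0 \<le> t" for k t
    using assms(2) that by (rule ivp_solution_eq_laplace_kernel)
  have T_rm: "T t (rm x q) = rm (T t x) q" if "0 \<le> t" for t x q
    using assms(3) that by (simp add: right_linear_semigroup_def bounded_right_linear_iff)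
  have R: "the_inv_into ?D (poly_operator P (generator T)) = ?R"
    using the_inv_poly_operator by simp
  have bij: "bij_betw (poly_operator P (generator T)) ?D UNIV"
    using bij_betw_poly_operator by simp
  have right_linear: "bounded_right_linear rm ?R"
    unfolding bounded_right_linear_iff
  proof (intro conjI allI bounded_linear_kernel_mean)
    fix x q
    have "rm (?R x) q = integral {0..} ((\<lambda>y. rm y q) \<circ> (\<lambda>t. laplace_kernel P 0 t *\<^sub>R T t x))"
      unfolding weighted_mean_def
      using integral_linear [OF exp_decaying_integrable [OF exp_decaying_kernel] bounded_linear_rm] by simp
    also have "\<dots> = ?R (rm x q)"
      unfolding weighted_mean_def
      by (intro Henstock_Kurzweil_Integration.integral_cong) (simp add: rm_scaleR T_rm)
    finally show "?R (rm x q) = rm (?R x) q"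
      by simp
  qed
  have combination: "has_strong_bochner_integral (lebesgue_on {0..})
      (\<lambda>t. T t (\<Sum>j\<in>J. ((half_line_deriv ^^ j) ?g t * (- 1) ^ j) *\<^sub>R y j))
      (\<Sum>j\<in>J. (generator T ^^ j) (?R (y j)))" if J: "J \<subseteq> {..m + 1}" for J and y :: "nat \<Rightarrow> 'x"
  proof -
    have fin: "finite J"
      using J by (rule finite_subset) simp
    let ?f = "\<lambda>t. T t (\<Sum>j\<in>J. ((half_line_deriv ^^ j) ?g t * (- 1) ^ j) *\<^sub>R y j)"
    let ?h = "\<lambda>t. \<Sum>j\<in>J. (- 1) ^ j *\<^sub>R (laplace_kernel P j t *\<^sub>R T t (y j))"
    have eq: "?f t = ?h t" if "0 \<le> t" for t
      using that g by (simp add: linear_sum [OF bounded_linear.linear [OF bounded_linear_T]]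
          linear_cmul [OF bounded_linear.linear [OF bounded_linear_T]] mult.commute)
    have "exp_decaying ?h"
      by (intro exp_decaying_sum exp_decaying_scaleR exp_decaying_kernel)
    then have "exp_decaying ?f"
      by (rule iffD2 [OF exp_decaying_cong, rotated]) (rule eq)
    from exp_decaying_has_strong_bochner_integral [OF this]
    have "has_strong_bochner_integral (lebesgue_on {0..}) ?f (integral {0..} ?f)" .
    also have "integral {0..} ?f = (\<Sum>j\<in>J. (generator T ^^ j) (?R (y j)))"
    proof -
      have "integral {0..} ?f = integral {0..} ?h"
        using eq by (intro Henstock_Kurzweil_Integration.integral_cong) auto
      also have "\<dots> = (\<Sum>j\<in>J. (- 1) ^ j *\<^sub>R weighted_mean (laplace_kernel P j) (y j))"
        unfolding weighted_mean_def
        by (subst integral_sum, rule fin, intro integrable_cmul exp_decaying_integrable [OF exp_decaying_kernel],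
            simp only: Henstock_Kurzweil_Integration.integral_cmul)
      also have "\<dots> = (\<Sum>j\<in>J. (generator T ^^ j) (?R (y j)))"
        using J by (intro sum.cong refl generator_power_kernel_mean(2) [symmetric]) auto
      finally show ?thesis .
    qed
    finally show ?thesis .
  qed
  let ?I = "Sigma (roots P) (\<lambda>\<mu>. {..<order \<mu> (complex_poly P)})"
  let ?S = "\<Sum>\<mu>\<in>roots P. \<Sum>k=1..order \<mu> (complex_poly P).
    cmod (laurent_coeff P \<mu> k) / (min_re_root P - \<omega>) ^ k"
  have fin: "finite (roots P)"
    unfolding roots_def using P by (intro poly_roots_finite) (simp add: complex_poly_eq_0_iff)
  have S: "(\<Sum>i\<in>?I. (case i of (\<mu>, k) \<Rightarrow> cmod (laurent_coeff P \<mu> (Suc k))) / (min_re_root P - \<omega>) ^ Suc (snd i)) = ?S"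
  proof -
    have "?S = (\<Sum>\<mu>\<in>roots P. \<Sum>k<order \<mu> (complex_poly P).
        cmod (laurent_coeff P \<mu> (Suc k)) / (min_re_root P - \<omega>) ^ Suc k)"
      by (simp only: One_nat_def sum.atLeast_Suc_atMost_Suc_shift sum.atLeast1_atMost_eq)
    also have "\<dots> = (\<Sum>(\<mu>, k)\<in>?I. cmod (laurent_coeff P \<mu> (Suc k)) / (min_re_root P - \<omega>) ^ Suc k)"
      using fin by (intro sum.Sigma) auto
    finally show ?thesis
      by (simp add: case_prod_unfold)
  qed
  have norm_R: "norm (?R x) \<le> M * ?S * norm x" for x
    unfolding S [symmetric]
  proof (rule norm_weighted_mean_le)
    show "finite ?I"
      using fin by auto
    show "\<bar>laplace_kernel P 0 t\<bar> \<le> (\<Sum>i\<in>?I. (case i of (\<mu>, k) \<Rightarrow> cmod (laurent_coeff P \<mu> (Suc k))) *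
        (t ^ snd i / fact (snd i) * exp (- min_re_root P * t)))" if "0 \<le> t" for t
      using laplace_kernel_le [OF P that] by (simp add: case_prod_unfold)
  qed (use assms(6) exp_decaying_kernel in auto)
  have "0 \<le> M * ?S"
  proof -
    have "onorm (T 0) * exp (- \<omega> * 0) \<le> M"
      unfolding assms(5) by (intro cSUP_upper assms(4)) auto
    then have "0 \<le> M"
      using onorm_pos_le [OF bounded_linear_T [of 0]] by simp
    moreover have "0 \<le> ?S"
      using assms(6) by (intro sum_nonneg) simp
    ultimately show ?thesis
      by simp
  qed
  then have onorm: "onorm ?R \<le> M * ?S"
    using norm_R by (rule onorm_bound)
  have integral: "has_strong_bochner_integral (lebesgue_on {0..}) (\<lambda>t. T t (?g t *\<^sub>R x)) (?R x)" for x
    using combination [of "{0}" "\<lambda>_. x"] by simp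
  have integrals: "has_strong_bochner_integral (lebesgue_on {0..})
      (\<lambda>t. T t (\<Sum>j=0..m+1. ((half_line_deriv ^^ j) ?g t * (- 1) ^ j) *\<^sub>R lm (p j) x))
      (\<Sum>j=0..m+1. (generator T ^^ j) (?R (lm (p j) x)))" for p :: "nat \<Rightarrow> 'n clifford" and x
    by (rule combination) auto
  show ?thesis
    unfolding Let_def R by (intro conjI allI bij right_linear onorm integral integrals)
qed

end
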